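(* There exist smooth, conformal, Lagrangian maps $u:\overline{D^2}\to\mathbb{C}^2$ with continuous Lagrangian angle which are $\Omega$-free boundary Hamiltonian stationary with the localization property for some open domain $\Omega\subset\mathbb{C}^2$ with smooth boundary, but which are not minimal.
   Context: $D^2\subset\mathbb{R}^2$ is the open unit disc, with coordinates $(x,y)$. On $\mathbb{C}^2\cong\mathbb{R}^4$ with coordinates $z_j=x_j+iy_j$, $\cdot$ and $\langle\cdot,\cdot\rangle$ denote the Euclidean real inner product, $I$ is complex multiplication by $i$, $\omega=dx_1\wedge dy_1+dx_2\wedge dy_2$, and $\nabla f$ is the Euclidean gradient of a real function $f$ on $\mathbb{C}^2$. A map $u$ on $D^2$ is Lagrangian if $u^*\omega=0$ a.e., and weakly conformal if $\langle\partial_xu,\partial_yu\rangle=0$ and $|\partial_xu|^2=|\partial_yu|^2$ a.e.; a smooth map is conformal if it is weakly conformal and an immersion. For a weakly conformal Lagrangian $u$ there is a measurable $g:D^2\to\mathbb{S}^1\subset\mathbb{C}$ with $u^*(dz_1\wedge dz_2)=e^{2\lambda}\overline{g}\,dx\wedge dy$ a.e., where $e^{2\lambda}=|\partial_xu|^2=|\partial_yu|^2$; $\overline{g}$ is called the Lagrangian angle of $u$. A conformal map is minimal if it is harmonic (so that it parametrizes a minimal surface). For an open $\Omega\subset\mathbb{C}^2$ with smooth boundary and outer normal $N$, a Lagrangian map $u\in C^1(\overline{D^2},\mathbb{C}^2)$ with $u(\partial D^2)\subset\partial\Omega$ is called $\Omega$-free boundary Hamiltonian stationary with the localization property if for every smooth,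 relatively open domain $U\subset\overline{D^2}$ $$\int_U\langle d(I(\nabla f)\circ u);du\rangle=0$$ for every smooth $f:\mathbb{C}^2\to\mathbb{R}$ supported away from $u(\partial U\cap D^2)$ such that $I\nabla f(x)\cdot N(x)=0$ for every $x$ in a neighbourhood of $u(\overline{U}\cap\partial D^2)$ in $\partial\Omega$. *)

theory Defs
  imports "HOL-Analysis.Analysis"
begin

section \<open>Differentiability classes\<close>

text \<open>
  Derivatives are taken within the set \<open>S\<close>.  This is only used for open \<open>S\<close>, where it is the
  ordinary notion, and for the closed unit disc, where derivatives within the set are unique as
  well and one obtains the functions with derivatives continuous up to the boundary.
\<close>

primrec Ck_on :: "nat \<Rightarrow> 'a::real_normed_vector set \<Rightarrow> ('a \<Rightarrow> 'b::real_normed_vector) \<Rightarrow> bool" where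
  "Ck_on 0 S f \<longleftrightarrow> continuous_on S f"
| "Ck_on (Suc k) S f \<longleftrightarrow>
     (\<forall>x\<in>S. f differentiable (at x within S)) \<and>
     (\<forall>v. Ck_on k S (\<lambda>x. frechet_derivative f (at x within S) v))"

definition smooth_on :: "'a::real_normed_vector set \<Rightarrow> ('a \<Rightarrow> 'b::real_normed_vector) \<Rightarrow> bool" where
  "smooth_on S f \<longleftrightarrow> (\<forall>k. Ck_on k S f)"

definition grad :: "('a::real_inner \<Rightarrow> real) \<Rightarrow> 'a \<Rightarrow> 'a" where
  "grad f x = (THE D. GDERIV f x :> D)"


section \<open>Sets with smooth boundary\<close>

text \<open>
  Near \<open>p\<close>, the subset \<open>S\<close> of the ambient set \<open>A\<close> is the part of \<open>A\<close> where \<open>\<rho> < 0\<close>.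
\<close>

definition local_defining_function ::
    "'a::real_inner set \<Rightarrow> 'a set \<Rightarrow> 'a \<Rightarrow> 'a set \<Rightarrow> ('a \<Rightarrow> real) \<Rightarrow> bool" where
  "local_defining_function A S p W \<rho> \<longleftrightarrow>
     open W \<and> p \<in> W \<and> smooth_on W \<rho> \<and> (\<forall>z\<in>W. grad \<rho> z \<noteq> 0) \<and>
     S \<inter> W = {z \<in> A \<inter> W. \<rho> z < 0}"

definition smooth_boundary :: "'a::real_inner set \<Rightarrow> bool" where
  "smooth_boundary \<Omega> \<longleftrightarrow> (\<forall>p\<in>frontier \<Omega>. \<exists>W \<rho>. local_defining_function UNIV \<Omega> p W \<rho>)"

definition outer_normal :: "'a::real_inner set \<Rightarrow> 'a \<Rightarrow> 'a" where
  "outer_normal \<Omega> p =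
     (THE n. \<exists>W \<rho>. local_defining_function UNIV \<Omega> p W \<rho> \<and> n = grad \<rho> p /\<^sub>R norm (grad \<rho> p))"

text \<open>
  Smooth, relatively open domains in the closed set \<open>A\<close>: the boundary of \<open>U\<close> relative to \<open>A\<close>,
  which for relatively open \<open>U\<close> is \<open>closure U - U\<close>, is smooth.  Points of \<open>U\<close> on the boundary
  of \<open>A\<close> are not part of the relative boundary, and the relative boundary may meet the boundary
  of \<open>A\<close> at any angle.
\<close>

definition smooth_relative_domain :: "'a::real_inner set \<Rightarrow> 'a set \<Rightarrow> bool" where
  "smooth_relative_domain A U \<longleftrightarrow>
     openin (top_of_set A) U \<and> connected U \<and> U \<noteq> {} \<and>
     (\<forall>p\<in>closure U - U. \<exists>W \<rho>. local_defining_function A U p W \<rho>)"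


section \<open>Maps from the closed unit disc to complex two-space\<close>

type_synonym R2 = "real \<times> real"
type_synonym C2 = "complex \<times> complex"

abbreviation disc :: "R2 set" where "disc \<equiv> ball 0 1"
abbreviation cdisc :: "R2 set" where "cdisc \<equiv> cball 0 1"

definition I_mult :: "C2 \<Rightarrow> C2" where
  "I_mult z = (\<i> * fst z, \<i> * snd z)"

definition omega :: "C2 \<Rightarrow> C2 \<Rightarrow> real" where
  "omega v w = (Re (fst v) * Im (fst w) - Im (fst v) * Re (fst w))
             + (Re (snd v) * Im (snd w) - Im (snd v) * Re (snd w))"

definition dz1_wedge_dz2 :: "C2 \<Rightarrow> C2 \<Rightarrow> complex" where
  "dz1_wedge_dz2 v w = fst v * snd w - fst w * snd v"

definition d_x :: "(R2 \<Rightarrow> 'b::real_normed_vector) \<Rightarrow> R2 \<Rightarrow> 'b" where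
  "d_x u p = frechet_derivative u (at p within cdisc) (1, 0)"

definition d_y :: "(R2 \<Rightarrow> 'b::real_normed_vector) \<Rightarrow> R2 \<Rightarrow> 'b" where
  "d_y u p = frechet_derivative u (at p within cdisc) (0, 1)"

definition lagrangian :: "(R2 \<Rightarrow> C2) \<Rightarrow> bool" where
  "lagrangian u \<longleftrightarrow> (AE p in lborel. p \<in> disc \<longrightarrow> omega (d_x u p) (d_y u p) = 0)"

definition weakly_conformal :: "(R2 \<Rightarrow> C2) \<Rightarrow> bool" where
  "weakly_conformal u \<longleftrightarrow>
     (AE p in lborel. p \<in> disc \<longrightarrow>
        d_x u p \<bullet> d_y u p = 0 \<and> (norm (d_x u p))\<^sup>2 = (norm (d_y u p))\<^sup>2)"

definition immersion :: "(R2 \<Rightarrow> C2) \<Rightarrow> bool" where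
  "immersion u \<longleftrightarrow> (\<forall>p\<in>cdisc. inj (frechet_derivative u (at p within cdisc)))"

definition conformal :: "(R2 \<Rightarrow> C2) \<Rightarrow> bool" where
  "conformal u \<longleftrightarrow> weakly_conformal u \<and> immersion u"

text \<open>
  Here \<open>\<beta>\<close> is the angle itself, that is the complex conjugate of the function \<open>g\<close> in
  \<open>u\<^sup>*(dz\<^sub>1 \<and> dz\<^sub>2) = e\<^sup>2\<^sup>\<lambda> cnj g dx \<and> dy\<close>, where \<open>e\<^sup>2\<^sup>\<lambda> = |\<partial>\<^sub>xu|\<^sup>2\<close>.
\<close>

definition lagrangian_angle :: "(R2 \<Rightarrow> C2) \<Rightarrow> (R2 \<Rightarrow> complex) \<Rightarrow> bool" where
  "lagrangian_angle u \<beta> \<longleftrightarrow>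
     \<beta> \<in> borel_measurable (lebesgue_on disc) \<and> \<beta> ` disc \<subseteq> sphere 0 1 \<and>
     (AE p in lborel. p \<in> disc \<longrightarrow>
        dz1_wedge_dz2 (d_x u p) (d_y u p) = of_real ((norm (d_x u p))\<^sup>2) * \<beta> p)"

definition harmonic :: "(R2 \<Rightarrow> C2) \<Rightarrow> bool" where
  "harmonic u \<longleftrightarrow> Ck_on 2 disc u \<and> (\<forall>p\<in>disc. d_x (d_x u) p + d_y (d_y u) p = 0)"

definition minimal :: "(R2 \<Rightarrow> C2) \<Rightarrow> bool" where
  "minimal u \<longleftrightarrow> conformal u \<and> harmonic u"


section \<open>Free boundary Hamiltonian stationary maps with the localization property\<close>

text \<open>
  The boundary of \<open>U\<close> inside the open disc is \<open>frontier U \<inter> disc\<close>, and a neighbourhood of \<open>K\<close>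
  in the boundary of \<open>\<Omega>\<close> is the trace of an open set of the ambient space containing \<open>K\<close>.
\<close>

definition admissible_hamiltonian ::
    "C2 set \<Rightarrow> (R2 \<Rightarrow> C2) \<Rightarrow> R2 set \<Rightarrow> (C2 \<Rightarrow> real) \<Rightarrow> bool" where
  "admissible_hamiltonian \<Omega> u U f \<longleftrightarrow>
     smooth_on UNIV f \<and>
     closure {z. f z \<noteq> 0} \<inter> u ` (frontier U \<inter> disc) = {} \<and>
     (\<exists>W. open W \<and> u ` (closure U \<inter> sphere 0 1) \<subseteq> W \<and>
          (\<forall>z \<in> W \<inter> frontier \<Omega>. I_mult (grad f z) \<bullet> outer_normal \<Omega> z = 0))"

definition free_boundary_ham_stationary_loc :: "C2 set \<Rightarrow> (R2 \<Rightarrow> C2) \<Rightarrow> bool" where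
  "free_boundary_ham_stationary_loc \<Omega> u \<longleftrightarrow>
     Ck_on 1 cdisc u \<and> lagrangian u \<and> u ` sphere 0 1 \<subseteq> frontier \<Omega> \<and>
     (\<forall>U f. smooth_relative_domain cdisc U \<longrightarrow> admissible_hamiltonian \<Omega> u U f \<longrightarrow>
        (LINT p:U|lborel. d_x (\<lambda>q. I_mult (grad f (u q))) p \<bullet> d_x u p
                        + d_y (\<lambda>q. I_mult (grad f (u q))) p \<bullet> d_y u p) = 0)"

end

theory Submission
  imports Defs
begin

text \<open>
  The example is a piece of a round cylinder, \<open>u (x, y) = (e\<^sup>i\<^sup>x, y)\<close>.  It is isometric and Lagrangian
  with Lagrangian angle \<open>i e\<^sup>i\<^sup>x\<close>, and it is not minimal since \<open>\<Delta>u = (- e\<^sup>i\<^sup>x, 0)\<close>.  The phase \<open>x\<close> of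
  the angle is harmonic, which makes \<open>u\<close> Hamiltonian stationary in the interior.  What remains is to
  find \<open>\<Omega>\<close> such that the boundary terms vanish.

  Let \<open>X = I \<nabla>f\<close> along \<open>u\<close> and \<open>F = f \<circ> u\<close>.  As \<open>X \<cdot> \<Delta>u = \<partial>\<^sub>x F\<close>, the integrand \<open>\<langle>dX; du\<rangle>\<close> is the
  divergence of \<open>(X \<cdot> \<partial>\<^sub>x u - F, X \<cdot> \<partial>\<^sub>y u)\<close>.  The normal component of this field on the circle contains
  \<open>F\<close> itself.  This is repaired with the harmonic conjugate \<open>y\<close> of the phase: adding the divergence
  free field \<open>(\<partial>\<^sub>y (y F), - \<partial>\<^sub>x (y F))\<close> gives
  \<open>W = (X \<cdot> \<partial>\<^sub>x u + y \<partial>\<^sub>y F, X \<cdot> \<partial>\<^sub>y u - y \<partial>\<^sub>x F)\<close>, and since \<open>\<partial>\<^sub>\<tau> F = X \<cdot> I \<partial>\<^sub>\<tau> u\<close>, the normal component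
  of \<open>W\<close> is \<open>X \<cdot> (\<partial>\<^sub>\<nu> u + y I \<partial>\<^sub>\<tau> u)\<close>.  So it suffices that the outer normal of \<open>\<Omega>\<close> along
  \<open>u(\<partial>D\<^sup>2)\<close> is parallel to \<open>\<partial>\<^sub>\<nu> u + y I \<partial>\<^sub>\<tau> u\<close>, a nowhere vanishing field orthogonal to the
  curve.  The boundary term then vanishes pointwise and not only after integration over the circle,
  which is why the localization property holds.

  Such an \<open>\<Omega>\<close> is the sublevel set \<open>\<rho>\<^sub>0 < 0\<close> of an explicit function in the coordinates \<open>Ln z\<^sub>1\<close> and
  \<open>z\<^sub>2\<close>; it is parametrized by a ball (\<open>connected_\<Omega>\<^sub>0\<close>), and \<open>0\<close> is a regular value of
  \<open>\<rho>\<^sub>0\<close> (\<open>grad_\<rho>\<^sub>0_nonzero\<close>).  Its outer normal is determined by any defining function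
  (\<open>unit_normal_unique\<close>), so admissible Hamiltonians satisfy \<open>W \<cdot> \<nu> = 0\<close> (\<open>W_tangential\<close>).

  The set \<open>U\<close> may meet the circle in a complicated way, and the support of \<open>f\<close> may reach the points
  where the inner boundary of \<open>U\<close> ends on the circle.  The integral of \<open>div W\<close> over \<open>U\<close> is therefore
  computed by cutting off radially near the circle (\<open>divergence_theorem_tangential\<close>): the error only
  involves the radial component of \<open>W\<close>, which tends to \<open>0\<close> at the circle at a linear rate.
\<close>

section \<open>Derivatives within a set and rules for differentiability classes\<close>

text \<open>
  Derivatives within a set are unique at each point that lies in a convex part of the set with
  nonempty interior.  The point itself may be a boundary point, so the condition covers the open
  sets and the closed disc alike, and the rules for \<open>Ck_on\<close> below can be proved once for both.
\<close>

definition locally_fat :: "'a::real_normed_vector set \<Rightarrow> bool" where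
  "locally_fat S \<longleftrightarrow> (\<forall>x\<in>S. \<exists>T\<subseteq>S. convex T \<and> x \<in> T \<and> interior T \<noteq> {})"

lemma locally_fat_open: "open S \<Longrightarrow> locally_fat S"
  unfolding locally_fat_def
  by (metis centre_in_ball convex_ball empty_iff interior_ball open_contains_ball)

lemma locally_fat_cball: "r > 0 \<Longrightarrow> locally_fat (cball a r)"
  unfolding locally_fat_def
proof (intro ballI exI conjI)
  show "interior (cball a r) \<noteq> {}" if "r > 0"
    using that centre_in_ball interior_maximal[OF ball_subset_cball open_ball, of a r] by blast
qed auto

text \<open>
  The difference \<open>D\<close> of two derivatives is a derivative of \<open>0\<close>.  The segment from \<open>x\<close> to
  any \<open>y \<in> T\<close> stays in \<open>T\<close>, so \<open>D (y - x) = 0\<close>; the vectors \<open>y - x\<close> fill a ball around some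
  \<open>c - x\<close>, and by linearity \<open>D\<close> vanishes on a ball around \<open>0\<close>.
\<close>

lemma has_derivative_unique_convex:
  fixes f :: "'a::real_normed_vector \<Rightarrow> 'b::real_normed_vector"
  assumes "convex T" "x \<in> T" "interior T \<noteq> {}"
    and "(f has_derivative D1) (at x within T)" "(f has_derivative D2) (at x within T)"
  shows "D1 = D2"
proof -
  define D where "D v = D1 v - D2 v" for v
  have der: "((\<lambda>x. 0) has_derivative D) (at x within T)"
    using has_derivative_diff[OF assms(4,5)] by (simp add: D_def[abs_def])
  interpret D: bounded_linear D using der by (rule has_derivative_bounded_linear)
  have on_T: "D (y - x) = 0" if "y \<in> T" for y
  proof -
    have seg: "(\<lambda>t::real. x + t *\<^sub>R (y - x)) ` {0..1} \<subseteq> T"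
      using convexD_alt[OF assms(1,2) that] by (auto simp: algebra_simps)
    have "((\<lambda>t::real. x + t *\<^sub>R (y - x)) has_derivative (\<lambda>t. t *\<^sub>R (y - x))) (at 0 within {0..1})"
      by (auto intro!: derivative_eq_intros)
    from has_derivative_in_compose[OF this, of "\<lambda>x. 0" D]
    have "((\<lambda>t::real. 0::'b) has_derivative (\<lambda>t. D (t *\<^sub>R (y - x)))) (at 0 within {0..1})"
      using has_derivative_subset[OF der seg] by simp
    then have "((\<lambda>t::real. 0::'b) has_vector_derivative D (y - x)) (at 0 within {0..1})"
      by (simp add: has_vector_derivative_def D.scaleR)
    moreover have "((\<lambda>t::real. 0::'b) has_vector_derivative 0) (at 0 within {0..1})"
      by simp
    ultimately show ?thesis
      using vector_derivative_unique_within_closed_interval[of 0 1 0 "\<lambda>t. 0"]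
      by (metis atLeastAtMost_iff box_real(2) less_numeral_extra(1) order_refl zero_le_one)
  qed
  obtain c e where e: "e > 0" "ball c e \<subseteq> T"
    using assms(3) by (metis equals0I mem_interior)
  have "D v = 0" for v
  proof -
    define t where "t = e / 2 / (norm v + 1)"
    have t: "t > 0" using e by (simp add: t_def add_nonneg_pos)
    have "norm (t *\<^sub>R v) < e"
    proof -
      have "norm v / (norm v + 1) \<le> 1" by (simp add: divide_le_eq_1 add_nonneg_pos)
      then have "(e/2) * (norm v / (norm v + 1)) \<le> (e/2) * 1"
        using e by (intro mult_left_mono) auto
      moreover have "norm (t *\<^sub>R v) = (e/2) * (norm v / (norm v + 1))"
        using t e by (simp add: t_def)
      ultimately show ?thesis using e by linarith
    qed
    then have "c + t *\<^sub>R v \<in> T" "c \<in> T" using e by (auto simp: dist_norm)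
    then have "D (c + t *\<^sub>R v - x) - D (c - x) = 0" using on_T by simp
    then have "t *\<^sub>R D v = 0" by (simp add: D.diff D.add D.scaleR)
    then show ?thesis using t by simp
  qed
  then show ?thesis by (auto simp: D_def fun_eq_iff)
qed

lemma frechet_derivative_within_fat:
  assumes "locally_fat S" "x \<in> S" "(f has_derivative D) (at x within S)"
  shows "frechet_derivative f (at x within S) = D"
proof -
  obtain T where T: "T \<subseteq> S" "convex T" "x \<in> T" "interior T \<noteq> {}"
    using assms(1,2) unfolding locally_fat_def by meson
  have "(f has_derivative frechet_derivative f (at x within S)) (at x within S)"
    using assms(3) differentiableI frechet_derivative_works by blast
  then show ?thesis
    using has_derivative_unique_convex[OF T(2-4)] has_derivative_subset[OF _ T(1)] assms(3) by blast
qed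

lemma Ck_on_cong:
  "(\<And>x. x \<in> S \<Longrightarrow> f x = g x) \<Longrightarrow> Ck_on k S f \<longleftrightarrow> Ck_on k S g"
proof (induction k arbitrary: f g)
  case 0
  then show ?case by (auto intro: continuous_on_eq)
next
  case (Suc k)
  have eq: "(f has_derivative D) (at x within S) \<longleftrightarrow> (g has_derivative D) (at x within S)"
    if "x \<in> S" for x D
    using Suc.prems that by (metis has_derivative_transform)
  have "frechet_derivative f (at x within S) = frechet_derivative g (at x within S)"
    if "x \<in> S" for x
    using eq[OF that] by (simp add: frechet_derivative_def)
  then have "Ck_on k S (\<lambda>x. frechet_derivative f (at x within S) v) =
     Ck_on k S (\<lambda>x. frechet_derivative g (at x within S) v)" for v
    by (intro Suc.IH) auto
  then show ?case using eq by (auto simp: differentiable_def)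
qed

text \<open>
  \<open>Ck_on\<close> refers to the derivative chosen by \<open>frechet_derivative\<close>; with this rule any explicit
  formula for the derivative can be used in its place.
\<close>

lemma Ck_on_SucI:
  assumes "locally_fat S"
    and D: "\<And>x. x \<in> S \<Longrightarrow> (f has_derivative D x) (at x within S)"
    and "\<And>v. Ck_on k S (\<lambda>x. D x v)"
  shows "Ck_on (Suc k) S f"
proof -
  have "Ck_on k S (\<lambda>x. frechet_derivative f (at x within S) v)" for v
    using Ck_on_cong[of S "\<lambda>x. frechet_derivative f (at x within S) v" "\<lambda>x. D x v"]
      frechet_derivative_within_fat[OF assms(1) _ D] assms(3) by auto
  then show ?thesis using D by (auto simp: differentiable_def)
qed

lemma Ck_on_SucD:
  assumes "Ck_on (Suc k) S f"
  obtains D where "\<And>x. x \<in> S \<Longrightarrow> (f has_derivative D x) (at x within S)"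
    and "\<And>v. Ck_on k S (\<lambda>x. D x v)"
proof (rule that[of "\<lambda>x. frechet_derivative f (at x within S)"])
  show "(f has_derivative frechet_derivative f (at x within S)) (at x within S)" if "x \<in> S" for x
    by (rule frechet_derivative_works[THEN iffD1]) (use assms that in simp)
  show "Ck_on k S (\<lambda>x. frechet_derivative f (at x within S) v)" for v
    using assms by simp
qed

lemma Ck_on_Suc_imp: "Ck_on (Suc k) S f \<Longrightarrow> Ck_on k S f"
proof (induction k arbitrary: f)
  case 0
  then show ?case
    by (simp add: continuous_on_eq_continuous_within differentiable_imp_continuous_within)
next
  case (Suc k)
  have "Ck_on k S (\<lambda>x. frechet_derivative f (at x within S) v)" for v
    using Suc.prems unfolding Ck_on.simps(2)[of "Suc k"] by (intro Suc.IH) blast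
  moreover have "\<forall>x\<in>S. f differentiable (at x within S)"
    using Suc.prems unfolding Ck_on.simps(2)[of "Suc k"] by blast
  ultimately show ?case unfolding Ck_on.simps(2)[of k] by blast
qed

lemma Ck_on_continuous: "Ck_on k S f \<Longrightarrow> continuous_on S f"
proof (induction k)
  case 0
  then show ?case by simp
next
  case (Suc k)
  then show ?case using Ck_on_Suc_imp by blast
qed

context
  fixes S :: "'a::real_normed_vector set"
  assumes fat: "locally_fat S"
begin

lemma Ck_on_const: "Ck_on k S (\<lambda>x. c)"
proof (induction k arbitrary: c)
  case 0
  show ?case by simp
next
  case (Suc k)
  show ?case
  proof (rule Ck_on_SucI[OF fat])
    show "((\<lambda>x. c) has_derivative (\<lambda>v. 0)) (at x within S)" for x
      by (rule has_derivative_const)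
  qed (rule Suc)
qed

lemma Ck_on_linear:
  assumes "bounded_linear L"
  shows "Ck_on k S L"
proof (cases k)
  case 0
  then show ?thesis using assms by (simp add: linear_continuous_on)
next
  case (Suc m)
  show ?thesis
    unfolding Suc
  proof (rule Ck_on_SucI[OF fat])
    show "(L has_derivative L) (at x within S)" for x
      by (rule bounded_linear_imp_has_derivative[OF assms])
  qed (rule Ck_on_const)
qed

lemma Ck_on_linear_compose:
  "bounded_linear L \<Longrightarrow> Ck_on k S f \<Longrightarrow> Ck_on k S (\<lambda>x. L (f x))"
proof (induction k arbitrary: f)
  case 0
  then show ?case
    by (auto intro: continuous_on_compose2[OF linear_continuous_on[of L UNIV]])
next
  case (Suc k)
  obtain D where D: "\<And>x. x \<in> S \<Longrightarrow> (f has_derivative D x) (at x within S)"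
    "\<And>v. Ck_on k S (\<lambda>x. D x v)"
    using Ck_on_SucD[OF Suc.prems(2)] by blast
  show ?case
  proof (rule Ck_on_SucI[OF fat])
    show "((\<lambda>x. L (f x)) has_derivative (\<lambda>v. L (D x v))) (at x within S)" if "x \<in> S" for x
      by (rule bounded_linear.has_derivative[OF Suc.prems(1) D(1)[OF that]])
    show "Ck_on k S (\<lambda>x. L (D x v))" for v
      by (intro Suc.IH Suc.prems(1) D(2))
  qed
qed

lemma Ck_on_add: "Ck_on k S f \<Longrightarrow> Ck_on k S g \<Longrightarrow> Ck_on k S (\<lambda>x. f x + g x)"
proof (induction k arbitrary: f g)
  case 0
  then show ?case by (auto intro: continuous_intros)
next
  case (Suc k)
  obtain D where D: "\<And>x. x \<in> S \<Longrightarrow> (f has_derivative D x) (at x within S)"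
    "\<And>v. Ck_on k S (\<lambda>x. D x v)"
    using Ck_on_SucD[OF Suc.prems(1)] by blast
  obtain E where E: "\<And>x. x \<in> S \<Longrightarrow> (g has_derivative E x) (at x within S)"
    "\<And>v. Ck_on k S (\<lambda>x. E x v)"
    using Ck_on_SucD[OF Suc.prems(2)] by blast
  show ?case
  proof (rule Ck_on_SucI[OF fat])
    show "((\<lambda>x. f x + g x) has_derivative (\<lambda>v. D x v + E x v)) (at x within S)" if "x \<in> S" for x
      by (rule has_derivative_add[OF D(1)[OF that] E(1)[OF that]])
    show "Ck_on k S (\<lambda>x. D x v + E x v)" for v
      by (intro Suc.IH D(2) E(2))
  qed
qed

lemma Ck_on_mult:
  fixes f g :: "'a \<Rightarrow> 'b::real_normed_algebra"
  shows "Ck_on k S f \<Longrightarrow> Ck_on k S g \<Longrightarrow> Ck_on k S (\<lambda>x. f x * g x)"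
proof (induction k arbitrary: f g)
  case 0
  then show ?case by (auto intro: continuous_intros)
next
  case (Suc k)
  obtain D where D: "\<And>x. x \<in> S \<Longrightarrow> (f has_derivative D x) (at x within S)"
    "\<And>v. Ck_on k S (\<lambda>x. D x v)"
    using Ck_on_SucD[OF Suc.prems(1)] by blast
  obtain E where E: "\<And>x. x \<in> S \<Longrightarrow> (g has_derivative E x) (at x within S)"
    "\<And>v. Ck_on k S (\<lambda>x. E x v)"
    using Ck_on_SucD[OF Suc.prems(2)] by blast
  show ?case
  proof (rule Ck_on_SucI[OF fat])
    show "((\<lambda>x. f x * g x) has_derivative (\<lambda>v. f x * E x v + D x v * g x)) (at x within S)" if "x \<in> S" for x
      by (rule has_derivative_mult[OF D(1)[OF that] E(1)[OF that]])
    show "Ck_on k S (\<lambda>x. f x * E x v + D x v * g x)" for v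
      by (intro Ck_on_add Suc.IH D(2) E(2) Ck_on_Suc_imp[OF Suc.prems(1)] Ck_on_Suc_imp[OF Suc.prems(2)])
  qed
qed

lemma Ck_on_Pair: "Ck_on k S f \<Longrightarrow> Ck_on k S g \<Longrightarrow> Ck_on k S (\<lambda>x. (f x, g x))"
proof (induction k arbitrary: f g)
  case 0
  then show ?case by (auto intro: continuous_intros)
next
  case (Suc k)
  obtain D where D: "\<And>x. x \<in> S \<Longrightarrow> (f has_derivative D x) (at x within S)"
    "\<And>v. Ck_on k S (\<lambda>x. D x v)"
    using Ck_on_SucD[OF Suc.prems(1)] by blast
  obtain E where E: "\<And>x. x \<in> S \<Longrightarrow> (g has_derivative E x) (at x within S)"
    "\<And>v. Ck_on k S (\<lambda>x. E x v)"
    using Ck_on_SucD[OF Suc.prems(2)] by blast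
  show ?case
  proof (rule Ck_on_SucI[OF fat])
    show "((\<lambda>x. (f x, g x)) has_derivative (\<lambda>v. (D x v, E x v))) (at x within S)" if "x \<in> S" for x
      by (rule has_derivative_Pair[OF D(1)[OF that] E(1)[OF that]])
    show "Ck_on k S (\<lambda>x. (D x v, E x v))" for v
      by (intro Suc.IH D(2) E(2))
  qed
qed

lemma Ck_on_exp:
  fixes f :: "'a \<Rightarrow> complex"
  shows "Ck_on k S f \<Longrightarrow> Ck_on k S (\<lambda>x. exp (f x))"
proof (induction k arbitrary: f)
  case 0
  then show ?case by (auto intro: continuous_intros)
next
  case (Suc k)
  obtain D where D: "\<And>x. x \<in> S \<Longrightarrow> (f has_derivative D x) (at x within S)"
    "\<And>v. Ck_on k S (\<lambda>x. D x v)"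
    using Ck_on_SucD[OF Suc.prems(1)] by blast
  show ?case
  proof (rule Ck_on_SucI[OF fat])
    show "((\<lambda>x. exp (f x)) has_derivative (\<lambda>v. exp (f x) * D x v)) (at x within S)"
      if "x \<in> S" for x
      using has_derivative_compose[OF D(1)[OF that]
          DERIV_exp[of "f x", unfolded has_field_derivative_def]] by simp
    show "Ck_on k S (\<lambda>x. exp (f x) * D x v)" for v
      using Ck_on_Suc_imp[OF Suc.prems] by (intro Ck_on_mult Suc.IH D)
  qed
qed

lemma Ck_on_inverse:
  fixes f :: "'a \<Rightarrow> complex"
  assumes "\<And>x. x \<in> S \<Longrightarrow> f x \<noteq> 0"
  shows "Ck_on k S f \<Longrightarrow> Ck_on k S (\<lambda>x. inverse (f x))"
proof (induction k)
  case 0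
  then show ?case using assms by (simp add: continuous_on_inverse)
next
  case (Suc k)
  obtain D where D: "\<And>x. x \<in> S \<Longrightarrow> (f has_derivative D x) (at x within S)"
    "\<And>v. Ck_on k S (\<lambda>x. D x v)"
    using Ck_on_SucD[OF Suc.prems(1)] by blast
  show ?case
  proof (rule Ck_on_SucI[OF fat])
    show "((\<lambda>x. inverse (f x)) has_derivative
        (\<lambda>v. (- 1) * (inverse (f x) * D x v * inverse (f x)))) (at x within S)"
      if "x \<in> S" for x
      using Deriv.has_derivative_inverse[OF assms[OF that] D(1)[OF that]] by simp
    show "Ck_on k S (\<lambda>x. (- 1) * (inverse (f x) * D x v * inverse (f x)))" for v
      using Suc.IH[OF Ck_on_Suc_imp[OF Suc.prems]] by (intro Ck_on_mult D Ck_on_const)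
  qed
qed

lemma Ck_on_Ln:
  fixes f :: "'a \<Rightarrow> complex"
  assumes slit: "\<And>x. x \<in> S \<Longrightarrow> f x \<notin> \<real>\<^sub>\<le>\<^sub>0" and f: "Ck_on k S f"
  shows "Ck_on k S (\<lambda>x. Ln (f x))"
proof (cases k)
  case 0
  then show ?thesis using assms by (simp add: continuous_on_Ln')
next
  case (Suc m)
  obtain D where D: "\<And>x. x \<in> S \<Longrightarrow> (f has_derivative D x) (at x within S)"
    "\<And>v. Ck_on m S (\<lambda>x. D x v)"
    using Ck_on_SucD f Suc by blast
  have nz: "f x \<noteq> 0" if "x \<in> S" for x using slit[OF that] by auto
  show ?thesis
    unfolding Suc
  proof (rule Ck_on_SucI[OF fat])
    show "((\<lambda>x. Ln (f x)) has_derivative (\<lambda>v. inverse (f x) * D x v)) (at x within S)"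
      if "x \<in> S" for x
      using has_derivative_compose[OF D(1)[OF that]
          has_field_derivative_Ln[OF slit[OF that], unfolded has_field_derivative_def]] by simp
    show "Ck_on m S (\<lambda>x. inverse (f x) * D x v)" for v
      using f Suc by (intro Ck_on_mult Ck_on_inverse D nz) (simp_all only: Ck_on_Suc_imp)
  qed
qed

end

section \<open>Symmetry of second derivatives\<close>

lemma smooth_on_SucD:
  assumes "smooth_on UNIV f"
  shows "(f has_derivative frechet_derivative f (at x)) (at x)"
    and "smooth_on UNIV (\<lambda>x. frechet_derivative f (at x) v)"
proof -
  have "Ck_on (Suc k) UNIV f" for k using assms by (simp add: smooth_on_def)
  then show "(f has_derivative frechet_derivative f (at x)) (at x)"
    "smooth_on UNIV (\<lambda>x. frechet_derivative f (at x) v)"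
    by (auto simp: smooth_on_def intro: frechet_derivative_works[THEN iffD1])
qed

text \<open>
  The mean value theorem is applied twice, first in the direction \<open>v\<close> and then in the direction
  \<open>w\<close>.  The left-hand side does not change when \<open>v\<close> and \<open>w\<close> are exchanged, which is
  the source of the symmetry of second derivatives.
\<close>

lemma second_difference:
  fixes f :: "'a::real_normed_vector \<Rightarrow> real"
  assumes D: "\<And>z. (f has_derivative D z) (at z)"
    and E: "\<And>z. ((\<lambda>z. D z v) has_derivative E z) (at z)"
    and "t > 0"
  obtains \<xi> \<eta> where "0 \<le> \<xi>" "\<xi> \<le> t" "0 \<le> \<eta>" "\<eta> \<le> t"
    "f (z + t *\<^sub>R v + t *\<^sub>R w) - f (z + t *\<^sub>R v) - f (z + t *\<^sub>R w) + f z
       = t\<^sup>2 * E (z + \<xi> *\<^sub>R v + \<eta> *\<^sub>R w) w"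
proof -
  have lin: "bounded_linear (D z)" "bounded_linear (E z)" for z
    using D E has_derivative_bounded_linear by blast+
  have Dsc: "D z (c *\<^sub>R h) = c * D z h" "E z (c *\<^sub>R h) = c * E z h" for z c h
    using lin[of z] by (auto simp: linear_simps)
  define g where "g s = f (z + s *\<^sub>R v + t *\<^sub>R w) - f (z + s *\<^sub>R v)" for s
  have g: "(g has_real_derivative (D (z + s *\<^sub>R v + t *\<^sub>R w) v - D (z + s *\<^sub>R v) v)) (at s)" for s
    unfolding g_def has_field_derivative_def
    by (auto intro!: derivative_eq_intros has_derivative_compose[OF _ D]
        simp: Dsc algebra_simps)
  obtain \<xi> where \<xi>: "0 < \<xi>" "\<xi> < t"
    "g t - g 0 = (t - 0) * (D (z + \<xi> *\<^sub>R v + t *\<^sub>R w) v - D (z + \<xi> *\<^sub>R v) v)"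
    using MVT2[OF \<open>t > 0\<close>, of g "\<lambda>s. D (z + s *\<^sub>R v + t *\<^sub>R w) v - D (z + s *\<^sub>R v) v"] g by blast
  define k where "k s = D (z + \<xi> *\<^sub>R v + s *\<^sub>R w) v" for s
  have k: "(k has_real_derivative E (z + \<xi> *\<^sub>R v + s *\<^sub>R w) w) (at s)" for s
  proof -
    have "((\<lambda>s. z + \<xi> *\<^sub>R v + s *\<^sub>R w) has_derivative (\<lambda>c. c *\<^sub>R w)) (at s)"
      by (auto intro!: derivative_eq_intros)
    from has_derivative_compose[OF this E]
    show ?thesis
      by (simp add: k_def[abs_def] has_field_derivative_def Dsc mult_commute_abs)
  qed
  obtain \<eta> where \<eta>: "0 < \<eta>" "\<eta> < t"
    "k t - k 0 = (t - 0) * E (z + \<xi> *\<^sub>R v + \<eta> *\<^sub>R w) w"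
    using MVT2[OF \<open>t > 0\<close>, of k "\<lambda>s. E (z + \<xi> *\<^sub>R v + s *\<^sub>R w) w"] k by blast
  show ?thesis
    using that[of \<xi> \<eta>] \<xi> \<eta> by (auto simp: g_def k_def power2_eq_square)
qed

lemma second_derivative_symmetric:
  fixes f :: "'a::real_normed_vector \<Rightarrow> real"
  assumes D: "\<And>z. (f has_derivative D z) (at z)"
    and E: "\<And>z. ((\<lambda>z. D z v) has_derivative E z) (at z)"
    and F: "\<And>z. ((\<lambda>z. D z w) has_derivative F z) (at z)"
    and cE: "continuous_on UNIV (\<lambda>z. E z w)" and cF: "continuous_on UNIV (\<lambda>z. F z v)"
  shows "E z w = F z v"
proof -
  define t where "t n = inverse (real (Suc n))" for n
  have t: "t n > 0" for n by (simp add: t_def)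
  have t0: "t \<longlonglongrightarrow> 0" unfolding t_def by (rule LIMSEQ_inverse_real_of_nat)
  \<comment> \<open>the same second difference, with the mean value theorem applied in either order\<close>
  have "\<exists>\<xi> \<eta> \<xi>' \<eta>'. 0 \<le> \<xi> \<and> \<xi> \<le> t n \<and> 0 \<le> \<eta> \<and> \<eta> \<le> t n \<and> 0 \<le> \<xi>' \<and> \<xi>' \<le> t n \<and> 0 \<le> \<eta>' \<and> \<eta>' \<le> t n
      \<and> E (z + \<xi> *\<^sub>R v + \<eta> *\<^sub>R w) w = F (z + \<xi>' *\<^sub>R w + \<eta>' *\<^sub>R v) v" for n
  proof -
    obtain \<xi> \<eta> where 1: "0 \<le> \<xi>" "\<xi> \<le> t n" "0 \<le> \<eta>" "\<eta> \<le> t n"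
      "f (z + t n *\<^sub>R v + t n *\<^sub>R w) - f (z + t n *\<^sub>R v) - f (z + t n *\<^sub>R w) + f z
         = (t n)\<^sup>2 * E (z + \<xi> *\<^sub>R v + \<eta> *\<^sub>R w) w"
      using second_difference[OF D E t] by metis
    obtain \<xi>' \<eta>' where 2: "0 \<le> \<xi>'" "\<xi>' \<le> t n" "0 \<le> \<eta>'" "\<eta>' \<le> t n"
      "f (z + t n *\<^sub>R w + t n *\<^sub>R v) - f (z + t n *\<^sub>R w) - f (z + t n *\<^sub>R v) + f z
         = (t n)\<^sup>2 * F (z + \<xi>' *\<^sub>R w + \<eta>' *\<^sub>R v) v"
      using second_difference[OF D F t] by metis
    have "(t n)\<^sup>2 * E (z + \<xi> *\<^sub>R v + \<eta> *\<^sub>R w) w = (t n)\<^sup>2 * F (z + \<xi>' *\<^sub>R w + \<eta>' *\<^sub>R v) v"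
      using 1(5) 2(5) by (simp add: algebra_simps)
    then show ?thesis using 1 2 t[of n] by auto
  qed
  then obtain \<xi> \<eta> \<xi>' \<eta>' where *: "\<And>n. 0 \<le> \<xi> n \<and> \<xi> n \<le> t n \<and> 0 \<le> \<eta> n \<and> \<eta> n \<le> t n
      \<and> 0 \<le> \<xi>' n \<and> \<xi>' n \<le> t n \<and> 0 \<le> \<eta>' n \<and> \<eta>' n \<le> t n
      \<and> E (z + \<xi> n *\<^sub>R v + \<eta> n *\<^sub>R w) w = F (z + \<xi>' n *\<^sub>R w + \<eta>' n *\<^sub>R v) v"
    by metis
  have lim: "s \<longlonglongrightarrow> 0" if "\<And>n. 0 \<le> s n \<and> s n \<le> t n" for s
    by (rule tendsto_sandwich[OF _ _ tendsto_const t0]) (use that in auto)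
  have "(\<lambda>n. z + \<xi> n *\<^sub>R v + \<eta> n *\<^sub>R w) \<longlonglongrightarrow> z + 0 *\<^sub>R v + 0 *\<^sub>R w"
    by (intro tendsto_intros lim) (use * in auto)
  moreover have "(\<lambda>n. z + \<xi>' n *\<^sub>R w + \<eta>' n *\<^sub>R v) \<longlonglongrightarrow> z + 0 *\<^sub>R w + 0 *\<^sub>R v"
    by (intro tendsto_intros lim) (use * in auto)
  ultimately have "(\<lambda>n. E (z + \<xi> n *\<^sub>R v + \<eta> n *\<^sub>R w) w) \<longlonglongrightarrow> E z w"
    "(\<lambda>n. F (z + \<xi>' n *\<^sub>R w + \<eta>' n *\<^sub>R v) v) \<longlonglongrightarrow> F z v"
    using continuous_on_tendsto_compose[OF cE] continuous_on_tendsto_compose[OF cF] by fastforce+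
  then show ?thesis using * LIMSEQ_unique by fastforce
qed

section \<open>A divergence theorem on relatively open subsets of the disc\<close>

text \<open>
  The derivative may be discontinuous, so this uses the fundamental theorem for the
  Henstock-Kurzweil integral, which agrees with the Lebesgue integral when the latter exists.
  If \<open>k\<close> is not Lebesgue integrable, then its integral is \<open>0\<close> by convention.
\<close>

lemma line_integral_of_derivative:
  fixes g k :: "real \<Rightarrow> real"
  assumes der: "\<And>x. (g has_real_derivative k x) (at x)"
    and g0: "\<And>x. 1 \<le> \<bar>x\<bar> \<Longrightarrow> g x = 0" and k0: "\<And>x. 1 < \<bar>x\<bar> \<Longrightarrow> k x = 0"
  shows "integral\<^sup>L lborel k = 0"
proof (cases "integrable lborel k")
  case True
  have "(k has_integral g 1 - g (-1)) {-1..1}"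
    using der by (intro fundamental_theorem_of_calculus)
      (auto simp: has_real_derivative_iff_has_vector_derivative intro: has_vector_derivative_at_within)
  moreover have "k x = 0" if "x \<notin> {-1..1}" for x using that by (intro k0) auto
  ultimately have "(k has_integral 0) UNIV"
    using has_integral_on_superset[of k 0 "{-1..1}" UNIV] by (simp add: g0)
  then show ?thesis
    using has_integral_integral_lborel[OF True] has_integral_unique by blast
qed (rule not_integrable_integral_eq)

lemma integral_divergence_compact_support:
  fixes V1 V2 v1 v2 :: "R2 \<Rightarrow> real"
  assumes d1: "\<And>x y. ((\<lambda>t. V1 (t, y)) has_real_derivative v1 (x, y)) (at x)"
    and d2: "\<And>x y. ((\<lambda>t. V2 (x, t)) has_real_derivative v2 (x, y)) (at y)"
    and zero: "\<And>p. p \<notin> disc \<Longrightarrow> V1 p = 0 \<and> V2 p = 0 \<and> v1 p = 0 \<and> v2 p = 0"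
    and int: "integrable lborel v1" "integrable lborel v2"
  shows "(\<integral>p. v1 p + v2 p \<partial>lborel) = 0"
proof -
  have out: "(x, y) \<notin> disc" if "1 \<le> \<bar>x\<bar> \<or> 1 \<le> \<bar>y\<bar>" for x y :: real
    using that norm_fst_le[of x y] norm_snd_le[of y x] by auto
  have i: "integrable (lborel \<Otimes>\<^sub>M lborel) v1" "integrable (lborel \<Otimes>\<^sub>M lborel) v2"
    using int by (simp_all add: lborel_prod)
  have "integral\<^sup>L lborel v1 = (\<integral>y. (\<integral>x. v1 (x, y) \<partial>lborel) \<partial>lborel)"
    using lborel_pair.integral_snd[of "\<lambda>x y. v1 (x, y)"] i by (simp add: lborel_prod)
  also have "\<dots> = 0"
    using line_integral_of_derivative[OF d1] zero out by simp
  finally have "integral\<^sup>L lborel v1 = 0" .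
  moreover have "integral\<^sup>L lborel v2 = (\<integral>x. (\<integral>y. v2 (x, y) \<partial>lborel) \<partial>lborel)"
    using lborel_pair.integral_fst'[of v2] i by (simp add: lborel_prod)
  then have "integral\<^sup>L lborel v2 = 0"
    using line_integral_of_derivative[OF d2] zero out by simp
  ultimately show ?thesis using int by simp
qed

text \<open>
  A \<open>C\<^sup>1\<close> function that vanishes for \<open>t \<le> 1\<close> and tends to \<open>1\<close> at infinity.  With
  \<open>s p = 1 - |p|\<^sup>2\<close>, the functions \<open>cutoff (n * s p)\<close> have compact support in the open disc and
  increase to \<open>1\<close> on it.  What matters besides is that \<open>t * cutoff' t\<close> is bounded and
  tends to \<open>0\<close>: the gradient of the cut-off grows like \<open>n\<close>, and this is compensated by
  multiplying it with a function of size \<open>O(s p)\<close>.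
\<close>

definition cutoff :: "real \<Rightarrow> real" where
  "cutoff t = 1 - 1 / (1 + (max 0 (t - 1))\<^sup>2)"

definition cutoff' :: "real \<Rightarrow> real" where
  "cutoff' t = 2 * max 0 (t - 1) / (1 + (max 0 (t - 1))\<^sup>2)\<^sup>2"

lemma one_plus_square_pos: "1 + x\<^sup>2 > (0::real)"
  by (simp add: add_pos_nonneg)

lemma one_plus_square_neq: "1 + x\<^sup>2 \<noteq> (0::real)"
  using one_plus_square_pos[of x] by simp

lemma pos_part_square_derivative:
  "((\<lambda>t::real. (max 0 (t - 1))\<^sup>2) has_real_derivative 2 * max 0 (t - 1)) (at t)"
proof -
  have eq: "(max 0 (t - 1))\<^sup>2 = (if t \<in> {..1} then 0 else (t - 1)\<^sup>2)" for t :: real by auto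
  have "((\<lambda>t::real. if t \<in> {..1} then 0 else (t - 1)\<^sup>2) has_derivative
      (if t \<in> {..1} then (\<lambda>h. 0) else (\<lambda>h. h * (2 * (t - 1))))) (at t within {..1} \<union> {1<..})"
    by (rule has_derivative_If_within_closures)
      (auto intro!: derivative_eq_intros simp: fun_eq_iff)
  moreover have "{..1} \<union> {1<..} = (UNIV :: real set)" by auto
  ultimately show ?thesis
    unfolding eq has_field_derivative_def
    by (auto simp: fun_eq_iff algebra_simps elim!: has_derivative_eq_rhs)
qed

lemma cutoff_derivative: "(cutoff has_real_derivative cutoff' t) (at t)"
  unfolding cutoff_def[abs_def] cutoff'_def
  by (rule derivative_eq_intros pos_part_square_derivative one_plus_square_neq refl)+
     (simp add: power2_eq_square)

lemma cutoff_eq_0: "t \<le> 1 \<Longrightarrow> cutoff t = 0" "t \<le> 1 \<Longrightarrow> cutoff' t = 0"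
  by (simp_all add: cutoff_def cutoff'_def)

lemma cutoff_bounds: "0 \<le> cutoff t" "cutoff t \<le> 1"
  using one_plus_square_pos[of "max 0 (t - 1)"]
  by (simp_all add: cutoff_def)

lemma cutoff_tail:
  assumes "t > 0"
  shows "1 - cutoff t \<le> 2 / t"
proof -
  have "t \<le> 2 * (1 + (max 0 (t - 1))\<^sup>2)"
  proof (cases "t \<le> 1")
    case False
    have "2 * (1 + (t - 1)\<^sup>2) - t = 2 * (t - 5/4)\<^sup>2 + 7/8" by (simp add: power2_eq_square algebra_simps)
    moreover have "(t - 5/4)\<^sup>2 \<ge> 0" by simp
    ultimately have "t \<le> 2 * (1 + (t - 1)\<^sup>2)" by linarith
    then show ?thesis using False by simp
  qed simp
  then show ?thesis using assms one_plus_square_pos[of "max 0 (t - 1)"]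
    by (simp add: cutoff_def field_simps)
qed

lemma cutoff'_bound: "\<bar>t * cutoff' t\<bar> \<le> 4 * (1 - cutoff t)"
proof (cases "t \<le> 1")
  case True
  then show ?thesis by (simp add: cutoff_def cutoff'_def)
next
  case False
  define m where "m = t - 1"
  have m: "m > 0" "t = m + 1" using False by (auto simp: m_def)
  have "(m + 1) * (2 * m) \<le> 4 * (1 + m\<^sup>2)"
  proof -
    have "4 * (1 + m\<^sup>2) - (m + 1) * (2 * m) = (m - 1)\<^sup>2 + m\<^sup>2 + 3"
      by (simp add: power2_eq_square algebra_simps)
    moreover have "(m - 1)\<^sup>2 + m\<^sup>2 + 3 \<ge> 0" by (simp add: add_nonneg_nonneg)
    ultimately show ?thesis by linarith
  qed
  then have "(m + 1) * (2 * m) / (1 + m\<^sup>2)\<^sup>2 \<le> 4 * (1 + m\<^sup>2) / (1 + m\<^sup>2)\<^sup>2"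
    by (intro divide_right_mono) auto
  also have "\<dots> = 4 / (1 + m\<^sup>2)"
    unfolding power2_eq_square[of "1 + m\<^sup>2"]
    by (rule nonzero_mult_divide_mult_cancel_right[OF one_plus_square_neq])
  finally show ?thesis using m by (simp add: cutoff_def cutoff'_def)
qed

lemma cutoff_limits:
  assumes "s > 0"
  shows "(\<lambda>n. cutoff (real n * s)) \<longlonglongrightarrow> 1"
    and "(\<lambda>n. real n * s * cutoff' (real n * s)) \<longlonglongrightarrow> 0"
proof -
  have lim: "(\<lambda>n. c * (2 / (real n * s))) \<longlonglongrightarrow> 0" for c
    using tendsto_mult[OF tendsto_const[of "c * 2 / s"] lim_inverse_n] by (simp add: field_simps)
  have ev: "\<forall>\<^sub>F n in sequentially. real n * s > 0"
    by (rule eventually_mono[OF eventually_gt_at_top[of 0]]) (use assms in simp)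
  have "(\<lambda>n. cutoff (real n * s) - 1) \<longlonglongrightarrow> 0"
  proof (rule Lim_null_comparison[OF _ lim[of 1]])
    show "\<forall>\<^sub>F n in sequentially. norm (cutoff (real n * s) - 1) \<le> 1 * (2 / (real n * s))"
      using ev
    proof eventually_elim
      case (elim n)
      show ?case using cutoff_tail[OF elim] cutoff_bounds[of "real n * s"] by simp
    qed
  qed
  then show "(\<lambda>n. cutoff (real n * s)) \<longlonglongrightarrow> 1" using LIM_zero_iff by blast
  show "(\<lambda>n. real n * s * cutoff' (real n * s)) \<longlonglongrightarrow> 0"
  proof (rule Lim_null_comparison[OF _ lim[of 4]])
    show "\<forall>\<^sub>F n in sequentially. norm (real n * s * cutoff' (real n * s)) \<le> 4 * (2 / (real n * s))"
      using ev
    proof eventually_elim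
      case (elim n)
      show ?case using cutoff_tail[OF elim] cutoff'_bound[of "real n * s"] by simp
    qed
  qed
qed

lemma C1_Lipschitz_on_cdisc:
  fixes T :: "R2 \<Rightarrow> real"
  assumes T: "\<And>p. (T has_derivative (\<lambda>h. fst h * a p + snd h * b p)) (at p)"
    and "continuous_on UNIV a" "continuous_on UNIV b"
  obtains L where "L \<ge> 0" "\<And>p q. p \<in> cdisc \<Longrightarrow> q \<in> cdisc \<Longrightarrow> \<bar>T p - T q\<bar> \<le> L * norm (p - q)"
proof -
  have bd: "\<exists>K. \<forall>p\<in>cdisc. norm (f p) \<le> K" if "continuous_on UNIV f" for f :: "R2 \<Rightarrow> real"
    using compact_continuous_image[OF continuous_on_subset[OF that] compact_cball]
    by (meson bounded_iff compact_imp_bounded image_eqI subset_UNIV)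
  obtain K where K: "\<And>p. p \<in> cdisc \<Longrightarrow> \<bar>a p\<bar> \<le> K" using bd assms(2) by fastforce
  obtain K' where K': "\<And>p. p \<in> cdisc \<Longrightarrow> \<bar>b p\<bar> \<le> K'" using bd assms(3) by fastforce
  have "\<bar>fst h * a p + snd h * b p\<bar> \<le> (K + K') * norm h" if "p \<in> cdisc" for p and h :: R2
  proof -
    have "\<bar>fst h\<bar> \<le> norm h" "\<bar>snd h\<bar> \<le> norm h"
      using norm_fst_le[of "fst h" "snd h"] norm_snd_le[of "snd h" "fst h"] by auto
    then have "\<bar>fst h\<bar> * \<bar>a p\<bar> \<le> norm h * K" "\<bar>snd h\<bar> * \<bar>b p\<bar> \<le> norm h * K'"
      using K[OF that] K'[OF that] by (intro mult_mono; simp)+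
    moreover have "\<bar>fst h * a p + snd h * b p\<bar> \<le> \<bar>fst h\<bar> * \<bar>a p\<bar> + \<bar>snd h\<bar> * \<bar>b p\<bar>"
      by (metis abs_mult abs_triangle_ineq)
    ultimately show ?thesis by (simp add: algebra_simps)
  qed
  then have on: "onorm (\<lambda>h. fst h * a p + snd h * b p) \<le> K + K'" if "p \<in> cdisc" for p
    using that by (intro onorm_le) auto
  have "\<bar>T p - T q\<bar> \<le> (K + K') * norm (p - q)" if "p \<in> cdisc" "q \<in> cdisc" for p q
    using differentiable_bound[of cdisc T _ "K + K'", OF convex_cball has_derivative_at_withinI[OF T] on that]
    by simp
  moreover have "K + K' \<ge> 0" using K[of 0] K'[of 0] by auto
  ultimately show ?thesis using that by blast
qed

text \<open>
  Go from \<open>p \<in> U\<close> radially to the unit circle.  Either the end point \<open>e\<close> lies in the closure of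
  \<open>U\<close>, or the segment leaves \<open>U\<close> at a point inside the disc; in both cases \<open>T\<close> vanishes at a
  point \<open>q\<close> of the segment, and \<open>|p - q| \<le> 1 - |p| \<le> 1 - |p|\<^sup>2\<close>.
\<close>

lemma vanishing_at_boundary_bound:
  fixes T :: "R2 \<Rightarrow> real"
  assumes Lip: "\<And>p q. p \<in> cdisc \<Longrightarrow> q \<in> cdisc \<Longrightarrow> \<bar>T p - T q\<bar> \<le> L * norm (p - q)" and "L \<ge> 0"
    and inner: "\<And>p. p \<in> frontier U \<inter> disc \<Longrightarrow> T p = 0"
    and outer: "\<And>p. p \<in> closure U \<inter> sphere 0 1 \<Longrightarrow> T p = 0"
    and T0: "T 0 = 0"
    and p: "p \<in> U" "p \<in> disc"
  shows "\<bar>T p\<bar> \<le> L * (1 - (norm p)\<^sup>2)"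
proof (cases "p = 0")
  case True
  then show ?thesis using T0 \<open>L \<ge> 0\<close> by simp
next
  case False
  define e where "e = p /\<^sub>R norm p"
  have e: "norm e = 1" using False by (simp add: e_def)
  have pe: "norm (p - e) = 1 - norm p"
  proof -
    have "p - e = (norm p - 1) *\<^sub>R e" using False by (simp add: e_def algebra_simps)
    then show ?thesis using e p(2) by simp
  qed
  have seg: "closed_segment p e \<subseteq> cdisc"
    using p(2) e by (intro closed_segment_subset) auto
  obtain q where q: "q \<in> closed_segment p e" "T q = 0"
  proof (cases "e \<in> closure U")
    case True
    then show ?thesis using that[of e] outer e by simp
  next
    case False
    then have "closed_segment p e \<inter> frontier U \<noteq> {}"
      using p(1) closure_subset by (intro connected_Int_frontier) auto
    then obtain q where q: "q \<in> closed_segment p e" "q \<in> frontier U" by blast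
    then have "q \<in> cdisc" "q \<in> closure U" using seg by (auto simp: frontier_def)
    then show ?thesis
      using that[of q] q inner[of q] outer[of q] by (cases "q \<in> disc") auto
  qed
  have "\<bar>T p\<bar> \<le> L * norm (p - q)"
    using Lip[of p q] q(2) subsetD[OF seg q(1)] p(2) by simp
  also have "\<dots> \<le> L * (1 - norm p)"
    using segment_bound1[OF q(1)] pe \<open>L \<ge> 0\<close> by (intro mult_left_mono) (auto simp: norm_minus_commute)
  also have "\<dots> \<le> L * (1 - (norm p)\<^sup>2)"
    using p(2) \<open>L \<ge> 0\<close> by (intro mult_left_mono) (auto simp: power_le_one_iff power2_eq_square mult_left_le)
  finally show ?thesis .
qed

lemma norm_R2: "(norm (p::R2))\<^sup>2 = (fst p)\<^sup>2 + (snd p)\<^sup>2"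
  by (simp add: norm_prod_def)

lemma open_inner_part:
  fixes U :: "R2 set"
  assumes U: "openin (top_of_set cdisc) U"
  shows "open (U \<inter> disc)"
proof -
  obtain T where "open T" "U = cdisc \<inter> T" using U by (auto simp: openin_open)
  moreover from this have "U \<inter> disc = T \<inter> disc" by auto
  ultimately show ?thesis by auto
qed

lemma integrable_localized:
  fixes f :: "R2 \<Rightarrow> real"
  assumes U: "openin (top_of_set cdisc) U" and f: "continuous_on UNIV f"
  shows "integrable lborel (\<lambda>p. if p \<in> U \<inter> disc then f p else 0)"
proof -
  have "integrable lborel (\<lambda>p. indicator cdisc p *\<^sub>R f p)"
    by (intro borel_integrable_compact continuous_on_subset[OF f]) auto
  then have "integrable lborel (\<lambda>p. indicator (U \<inter> disc) p *\<^sub>R (indicator cdisc p *\<^sub>R f p))"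
    by (rule integrable_mult_indicator[rotated]) (simp add: open_inner_part[OF U])
  then show ?thesis
    by (elim back_subst[of "integrable lborel"]) (auto simp: indicator_def)
qed

lemma continuous_cutoff:
  "continuous_on UNIV (\<lambda>p::R2. cutoff (c * (1 - (norm p)\<^sup>2)))"
  "continuous_on UNIV (\<lambda>p::R2. cutoff' (c * (1 - (norm p)\<^sup>2)))"
proof -
  have "continuous_on UNIV cutoff" "continuous_on UNIV cutoff'"
    unfolding cutoff_def[abs_def] cutoff'_def[abs_def]
    by (intro continuous_intros; simp add: one_plus_square_neq)+
  note c = this[THEN continuous_on_compose2, OF _ subset_UNIV]
  show "continuous_on UNIV (\<lambda>p::R2. cutoff (c * (1 - (norm p)\<^sup>2)))"
    "continuous_on UNIV (\<lambda>p::R2. cutoff' (c * (1 - (norm p)\<^sup>2)))"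
    by (intro c continuous_intros)+
qed

context
  fixes U :: "R2 set" and W :: "R2 \<Rightarrow> real" and a b :: "R2 \<Rightarrow> real" and n :: nat
  assumes U: "openin (top_of_set cdisc) U"
    and W: "\<And>p. (W has_derivative (\<lambda>h. fst h * a p + snd h * b p)) (at p)"
    and van: "\<And>p. p \<in> frontier U \<inter> disc \<Longrightarrow> \<forall>\<^sub>F q in nhds p. W q = 0"
begin

abbreviation "chi (p::R2) \<equiv> cutoff (real n * (1 - (norm p)\<^sup>2))"
abbreviation "chi' (p::R2) \<equiv> cutoff' (real n * (1 - (norm p)\<^sup>2)) * (- 2 * real n)"

text \<open>
  Cut off and extended by \<open>0\<close>, the function \<open>W\<close> is differentiable everywhere.  At points of
  the disc on the frontier of \<open>U\<close> this uses that \<open>W\<close> vanishes in a whole neighbourhood, and outside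
  the disc that the cut-off does.
\<close>

lemma has_derivative_localized:
  "((\<lambda>p. if p \<in> U \<inter> disc then chi p * W p else 0) has_derivative
     (\<lambda>h. if p \<in> U \<inter> disc then fst h * (chi p * a p + chi' p * fst p * W p)
        + snd h * (chi p * b p + chi' p * snd p * W p) else 0)) (at p)"
proof (cases "p \<in> U \<inter> disc")
  case True
  have "((\<lambda>p. real n * (1 - ((fst p)\<^sup>2 + (snd p)\<^sup>2))) has_derivative
      (\<lambda>h. - 2 * real n * (fst h * fst p + snd h * snd p))) (at p)" for p :: R2
    by (auto intro!: derivative_eq_intros simp: algebra_simps)
  from has_derivative_compose[OF this cutoff_derivative[unfolded has_field_derivative_def]]
  have "(chi has_derivative (\<lambda>h. chi' p * (fst h * fst p + snd h * snd p))) (at p)"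
    by (simp add: norm_R2 mult.assoc)
  from has_derivative_mult[OF this W[of p]]
  have "((\<lambda>p. chi p * W p) has_derivative (\<lambda>h. fst h * (chi p * a p + chi' p * fst p * W p)
        + snd h * (chi p * b p + chi' p * snd p * W p))) (at p)"
    by (rule has_derivative_eq_rhs) (simp add: algebra_simps)
  then show ?thesis
    using True by (auto intro: has_derivative_transform_within_open[OF _ open_inner_part[OF U] True])
next
  case False
  have "\<exists>X. open X \<and> p \<in> X \<and> (\<forall>q\<in>X. q \<in> U \<inter> disc \<longrightarrow> chi q * W q = 0)"
  proof (cases "p \<in> disc")
    case True
    show ?thesis
    proof (cases "p \<in> closure U")
      case True
      then have "p \<in> frontier U \<inter> disc"
        using False \<open>p \<in> disc\<close> interior_subset[of U] by (auto simp: frontier_def)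
      then show ?thesis using van[of p] unfolding eventually_nhds by auto
    next
      case False
      then show ?thesis using closure_subset[of U] by (intro exI[of _ "- closure U"]) auto
    qed
  next
    case False
    have "real n * (1 - (norm p)\<^sup>2) \<le> 0"
      using False by (intro mult_nonneg_nonpos) (auto simp: one_le_power)
    moreover have "open {q::R2. real n * (1 - (norm q)\<^sup>2) < 1}"
      by (intro open_Collect_less continuous_intros)
    ultimately show ?thesis
      by (intro exI[of _ "{q. real n * (1 - (norm q)\<^sup>2) < 1}"]) (auto simp: cutoff_eq_0)
  qed
  then obtain X where X: "open X" "p \<in> X" "\<And>q. q \<in> X \<Longrightarrow> q \<in> U \<inter> disc \<Longrightarrow> chi q * W q = 0"
    by blast
  have "((\<lambda>p. if p \<in> U \<inter> disc then chi p * W p else 0) has_derivative (\<lambda>h. 0)) (at p)"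
    by (rule has_derivative_transform_within_open[OF has_derivative_const[of 0] X(1,2)])
       (use X(3) in auto)
  then show ?thesis using False by (simp only: if_False)
qed

end

text \<open>
  A divergence theorem without boundary terms: the field \<open>(W1, W2)\<close> vanishes near the part of
  the boundary of \<open>U\<close> inside the disc, hence extends by \<open>0\<close> to the open disc, and it is tangential
  to the unit circle along the rest.
  For the cut-off field the integral of the divergence is \<open>0\<close>.  Removing the cut-off leaves
  the error term \<open>\<nabla>(cutoff (n * s)) \<cdot> W\<close>, where \<open>s p = 1 - |p|\<^sup>2\<close>, which by rotational symmetry of the cut-off involves only the
  radial component \<open>T p = p \<cdot> W p\<close>.  As \<open>T\<close> is Lipschitz and vanishes where the radial segment
  leaves \<open>U\<close>, it is \<open>O(1 - |p|\<^sup>2)\<close> on \<open>U\<close>, and dominated convergence applies.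
\<close>

proposition divergence_theorem_tangential:
  fixes U :: "R2 set" and W1 W2 a1 b1 a2 b2 :: "R2 \<Rightarrow> real"
  assumes U: "openin (top_of_set cdisc) U"
    and W1: "\<And>p. (W1 has_derivative (\<lambda>h. fst h * a1 p + snd h * b1 p)) (at p)"
    and W2: "\<And>p. (W2 has_derivative (\<lambda>h. fst h * a2 p + snd h * b2 p)) (at p)"
    and cont: "continuous_on UNIV a1" "continuous_on UNIV b1"
      "continuous_on UNIV a2" "continuous_on UNIV b2"
    and van: "\<And>p. p \<in> frontier U \<inter> disc \<Longrightarrow> \<forall>\<^sub>F q in nhds p. W1 q = 0 \<and> W2 q = 0"
    and tang: "\<And>p. p \<in> closure U \<inter> sphere 0 1 \<Longrightarrow> fst p * W1 p + snd p * W2 p = 0"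
  shows "(LINT p:U|lborel. a1 p + b2 p) = 0"
proof -
  define T where "T p = fst p * W1 p + snd p * W2 p" for p
  have cW: "continuous_on UNIV W1" "continuous_on UNIV W2"
    using has_derivative_continuous[OF W1] has_derivative_continuous[OF W2]
    by (simp_all add: continuous_at_imp_continuous_on)
  have van1: "\<forall>\<^sub>F q in nhds p. W1 q = 0" if "p \<in> frontier U \<inter> disc" for p
    using van[OF that] by (rule eventually_mono) (rule conjunct1)
  have van2: "\<forall>\<^sub>F q in nhds p. W2 q = 0" if "p \<in> frontier U \<inter> disc" for p
    using van[OF that] by (rule eventually_mono) (rule conjunct2)
  obtain L where L: "L \<ge> 0" "\<And>p q. p \<in> cdisc \<Longrightarrow> q \<in> cdisc \<Longrightarrow> \<bar>T p - T q\<bar> \<le> L * norm (p - q)"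
  proof (rule C1_Lipschitz_on_cdisc)
    show "(T has_derivative (\<lambda>h. fst h * (W1 p + fst p * a1 p + snd p * a2 p)
        + snd h * (W2 p + fst p * b1 p + snd p * b2 p))) (at p)" for p
      unfolding T_def[abs_def]
      by (rule derivative_eq_intros W1 W2 refl)+ (simp add: algebra_simps)
  qed (intro continuous_intros cW cont | blast)+
  \<comment> \<open>This bound absorbs the factor \<open>n\<close> from differentiating the cut-off.\<close>
  have Tb: "\<bar>T p\<bar> \<le> L * (1 - (norm p)\<^sup>2)" if "p \<in> U" "p \<in> disc" for p
  proof (rule vanishing_at_boundary_bound[where U = U])
    show "T q = 0" if "q \<in> frontier U \<inter> disc" for q
      using van[OF that] by (auto simp: T_def dest: eventually_nhds_x_imp_x)
    show "T q = 0" if "q \<in> closure U \<inter> sphere 0 1" for q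
      using tang[OF that] by (simp add: T_def)
  qed (use L that in \<open>auto simp: T_def\<close>)
  define c where "c n p = cutoff (real n * (1 - (norm p)\<^sup>2))" for n and p :: R2
  define c' where "c' n p = cutoff' (real n * (1 - (norm p)\<^sup>2)) * (- 2 * real n)" for n and p :: R2
  define v1 where "v1 n p = (if p \<in> U \<inter> disc then c n p * a1 p + c' n p * fst p * W1 p else 0)" for n p
  define v2 where "v2 n p = (if p \<in> U \<inter> disc then c n p * b2 p + c' n p * snd p * W2 p else 0)" for n p
  have cc: "continuous_on UNIV (c n)" "continuous_on UNIV (c' n)" for n
    unfolding c_def[abs_def] c'_def[abs_def] by (intro continuous_intros continuous_cutoff)+
  have int: "integrable lborel (v1 n)" "integrable lborel (v2 n)" for n
    unfolding v1_def[abs_def] v2_def[abs_def]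
    by (intro integrable_localized[OF U] continuous_intros cc cW cont)+
  have zero: "(\<integral>p. v1 n p + v2 n p \<partial>lborel) = 0" for n
  proof (rule integral_divergence_compact_support)
    define V1 where "V1 p = (if p \<in> U \<inter> disc then c n p * W1 p else 0)" for p
    define V2 where "V2 p = (if p \<in> U \<inter> disc then c n p * W2 p else 0)" for p
    have lines: "((\<lambda>t. (t, y)) has_derivative (\<lambda>h. (h, 0))) (at x)"
      "((\<lambda>t. (x, t)) has_derivative (\<lambda>h. (0, h))) (at y)" for x y :: real
      by (auto intro!: derivative_eq_intros)
    have "(V1 has_derivative (\<lambda>h. if p \<in> U \<inter> disc
        then fst h * (c n p * a1 p + c' n p * fst p * W1 p)
          + snd h * (c n p * b1 p + c' n p * snd p * W1 p) else 0)) (at p)" for p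
      unfolding V1_def[abs_def] c_def c'_def by (rule has_derivative_localized[OF U W1 van1])
    note V1 = has_derivative_compose[OF lines(1) this]
    have "(V2 has_derivative (\<lambda>h. if p \<in> U \<inter> disc
        then fst h * (c n p * a2 p + c' n p * fst p * W2 p)
          + snd h * (c n p * b2 p + c' n p * snd p * W2 p) else 0)) (at p)" for p
      unfolding V2_def[abs_def] c_def c'_def by (rule has_derivative_localized[OF U W2 van2])
    note V2 = has_derivative_compose[OF lines(2) this]
    show "((\<lambda>t. V1 (t, y)) has_real_derivative v1 n (x, y)) (at x)" for x y
      unfolding has_field_derivative_def
      by (rule has_derivative_eq_rhs[OF V1]) (auto simp: v1_def fun_eq_iff)
    show "((\<lambda>t. V2 (x, t)) has_real_derivative v2 n (x, y)) (at y)" for x y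
      unfolding has_field_derivative_def
      by (rule has_derivative_eq_rhs[OF V2]) (auto simp: v2_def fun_eq_iff)
    show "V1 p = 0 \<and> V2 p = 0 \<and> v1 n p = 0 \<and> v2 n p = 0" if "p \<notin> disc" for p
      using that by (simp add: V1_def V2_def v1_def v2_def)
  qed (rule int)+
  have sum: "v1 n p + v2 n p = c n p * (a1 p + b2 p) + c' n p * T p" if "p \<in> U" "p \<in> disc" for n p
    using that by (simp add: v1_def v2_def T_def algebra_simps)
  obtain K where K: "\<And>p. p \<in> cdisc \<Longrightarrow> \<bar>a1 p + b2 p\<bar> \<le> K"
  proof -
    have "continuous_on cdisc (\<lambda>p. a1 p + b2 p)"
      by (intro continuous_intros continuous_on_subset[OF cont(1)] continuous_on_subset[OF cont(4)]) auto
    then have "bounded ((\<lambda>p. a1 p + b2 p) ` cdisc)"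
      by (intro compact_imp_bounded compact_continuous_image) auto
    then obtain K where "\<forall>x\<in>(\<lambda>p. a1 p + b2 p) ` cdisc. norm x \<le> K" unfolding bounded_iff ..
    then show ?thesis by (intro that[of K]) simp
  qed
  have c'T: "\<bar>c' n p * T p\<bar> \<le> 2 * L * \<bar>real n * (1 - (norm p)\<^sup>2) * cutoff' (real n * (1 - (norm p)\<^sup>2))\<bar>"
    if "p \<in> U" "p \<in> disc" for n p
  proof -
    have s: "1 - (norm p)\<^sup>2 \<ge> 0" using that by (simp add: power_le_one)
    have "\<bar>c' n p * T p\<bar> = \<bar>c' n p\<bar> * \<bar>T p\<bar>" by (simp add: abs_mult)
    also have "\<dots> \<le> \<bar>c' n p\<bar> * (L * (1 - (norm p)\<^sup>2))"
      using Tb[OF that] by (rule mult_left_mono) simp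
    also have "\<dots> = 2 * L * \<bar>real n * (1 - (norm p)\<^sup>2) * cutoff' (real n * (1 - (norm p)\<^sup>2))\<bar>"
      using s by (simp add: c'_def abs_mult)
    finally show ?thesis .
  qed
  have K0: "K \<ge> 0" using K[of 0] by auto
  define f where "f p = (if p \<in> U \<inter> disc then a1 p + b2 p else 0)" for p
  have "(\<lambda>n. \<integral>p. v1 n p + v2 n p \<partial>lborel) \<longlonglongrightarrow> (\<integral>p. f p \<partial>lborel)"
  proof (rule integral_dominated_convergence)
    show "integrable lborel (\<lambda>p::R2. indicator cdisc p *\<^sub>R (K + 8 * L))"
      by (intro borel_integrable_compact) auto
    show "f \<in> borel_measurable lborel"
      using integrable_localized[OF U, of "\<lambda>p. a1 p + b2 p"] cont
      unfolding f_def[abs_def] by (intro borel_measurable_integrable) (auto intro: continuous_intros)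
    show "(\<lambda>p. v1 n p + v2 n p) \<in> borel_measurable lborel" for n
      using int[of n] by (intro borel_measurable_add borel_measurable_integrable)
    have "(\<lambda>n. v1 n p + v2 n p) \<longlonglongrightarrow> f p" for p
    proof (cases "p \<in> U \<inter> disc")
      case True
      then have s: "1 - (norm p)\<^sup>2 > 0" by (simp add: power_less_one_iff abs_square_less_1)
      note lim = cutoff_limits[OF s]
      have "(\<lambda>n. c' n p * T p) \<longlonglongrightarrow> 0"
      proof (rule Lim_null_comparison)
        show "\<forall>\<^sub>F n in sequentially. norm (c' n p * T p) \<le>
            2 * L * \<bar>real n * (1 - (norm p)\<^sup>2) * cutoff' (real n * (1 - (norm p)\<^sup>2))\<bar>"
          using c'T True by auto
        show "(\<lambda>n. 2 * L * \<bar>real n * (1 - (norm p)\<^sup>2) * cutoff' (real n * (1 - (norm p)\<^sup>2))\<bar>) \<longlonglongrightarrow> 0"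
          using tendsto_mult[OF tendsto_const[of "2 * L"] tendsto_rabs[OF lim(2)]] by simp
      qed
      moreover have "(\<lambda>n. c n p * (a1 p + b2 p)) \<longlonglongrightarrow> 1 * (a1 p + b2 p)"
        unfolding c_def by (intro tendsto_intros lim)
      ultimately have "(\<lambda>n. c n p * (a1 p + b2 p) + c' n p * T p) \<longlonglongrightarrow> 1 * (a1 p + b2 p) + 0"
        by (rule tendsto_add[rotated])
      then show ?thesis using True sum by (simp add: f_def)
    next
      case False
      then show ?thesis by (simp only: f_def v1_def v2_def if_False add_0 tendsto_const)
    qed
    then show "AE p in lborel. (\<lambda>n. v1 n p + v2 n p) \<longlonglongrightarrow> f p" by simp
    have "norm (v1 n p + v2 n p) \<le> indicator cdisc p *\<^sub>R (K + 8 * L)" for n p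
    proof (cases "p \<in> U \<inter> disc")
      case True
      then have p: "p \<in> U" "p \<in> disc" "p \<in> cdisc" by auto
      have "\<bar>c n p * (a1 p + b2 p)\<bar> \<le> 1 * K"
        unfolding abs_mult using K[OF p(3)] cutoff_bounds K0 by (intro mult_mono) (auto simp: c_def)
      moreover have "\<bar>c' n p * T p\<bar> \<le> 2 * L * 4"
      proof (rule order_trans[OF c'T[OF p(1,2)]])
        have "\<bar>t * cutoff' t\<bar> \<le> 4" for t
          by (rule order_trans[OF cutoff'_bound]) (use cutoff_bounds(1)[of t] in simp)
        then show "2 * L * \<bar>real n * (1 - (norm p)\<^sup>2) * cutoff' (real n * (1 - (norm p)\<^sup>2))\<bar> \<le> 2 * L * 4"
          using L(1) by (intro mult_left_mono) auto
      qed
      ultimately show ?thesis using sum[OF p(1,2)] p(3) by simp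
    next
      case False
      then show ?thesis using K0 L(1) by (auto simp: v1_def v2_def indicator_def)
    qed
    then show "AE p in lborel. norm (v1 n p + v2 n p) \<le> indicator cdisc p *\<^sub>R (K + 8 * L)" for n
      by simp
  qed
  then have "(\<integral>p. f p \<partial>lborel) = 0"
    using zero LIMSEQ_unique[OF _ tendsto_const] by auto
  moreover have "(LINT p:U|lborel. a1 p + b2 p) = (\<integral>p. f p \<partial>lborel)"
    unfolding set_lebesgue_integral_def
  proof (rule integral_cong_AE)
    \<comment> \<open>\<open>U\<close> may contain points of the circle, where the cut-off fields vanish\<close>
    have "negligible (sphere (0::R2) 1)"
      using negligible_convex_frontier[OF convex_cball, of "0::R2" 1] by simp
    then have "sphere (0::R2) 1 \<in> null_sets lborel"
      by (simp add: null_sets_completion_iff negligible_iff_null_sets)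
    then have "AE p in lborel. p \<notin> sphere (0::R2) 1" by (rule AE_not_in)
    moreover have "indicator U p *\<^sub>R (a1 p + b2 p) = f p" if "p \<notin> sphere (0::R2) 1" for p
      using that openin_imp_subset[OF U] by (auto simp: f_def indicator_def)
    ultimately show "AE p in lborel. indicator U p *\<^sub>R (a1 p + b2 p) = f p"
      by (rule eventually_mono)
    have "U \<in> sets borel" using U by (auto simp: openin_open)
    then show "(\<lambda>p. indicator U p *\<^sub>R (a1 p + b2 p)) \<in> borel_measurable lborel"
      using borel_measurable_continuous_onI[OF continuous_on_add[OF cont(1,4)]]
      by (intro borel_measurable_scaleR borel_measurable_indicator) simp_all
    show "f \<in> borel_measurable lborel"
      using integrable_localized[OF U, of "\<lambda>p. a1 p + b2 p"] cont
      unfolding f_def[abs_def] by (intro borel_measurable_integrable) (auto intro: continuous_intros)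
  qed
  ultimately show ?thesis by simp
qed

section \<open>Gradients and outer normals\<close>

lemma has_derivative_grad:
  fixes f :: "'a::euclidean_space \<Rightarrow> real"
  assumes "(f has_derivative D) (at x)"
  shows "D h = h \<bullet> grad f x"
proof -
  define g where "g = (\<Sum>b\<in>Basis. D b *\<^sub>R b)"
  have lin: "linear D" using assms has_derivative_linear by blast
  have D: "D h = h \<bullet> g" for h
  proof -
    have "D h = D (\<Sum>b\<in>Basis. (h \<bullet> b) *\<^sub>R b)" by (simp add: euclidean_representation)
    also have "\<dots> = (\<Sum>b\<in>Basis. (h \<bullet> b) * D b)"
      using lin by (simp add: linear_sum linear_scale)
    also have "\<dots> = h \<bullet> g" by (simp add: g_def inner_sum_right mult.commute)
    finally show ?thesis .
  qed
  have "grad f x = g"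
    unfolding grad_def
  proof (rule the_equality)
    show "GDERIV f x :> g"
      using assms unfolding gderiv_def by (rule has_derivative_eq_rhs) (simp add: D fun_eq_iff)
    show "g' = g" if "GDERIV f x :> g'" for g'
    proof -
      have "(\<lambda>h. h \<bullet> g') = D"
        using has_derivative_unique[OF _ assms] that unfolding gderiv_def by blast
      then have "(g' - g) \<bullet> (g' - g) = 0"
        by (metis D inner_diff_right right_minus_eq)
      then show ?thesis by simp
    qed
  qed
  then show ?thesis using D by simp
qed

lemma local_defining_function_has_derivative:
  assumes "local_defining_function A S p W \<rho>" "z \<in> W"
  shows "(\<rho> has_derivative frechet_derivative \<rho> (at z)) (at z)"
proof -
  have "smooth_on W \<rho>" "open W"
    using assms(1) by (simp_all only: local_defining_function_def)
  then have "Ck_on (Suc 0) W \<rho>" by (simp only: smooth_on_def)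
  then have "\<rho> differentiable (at z within W)" using assms(2) by simp
  then have "\<rho> differentiable (at z)"
    using at_within_open[OF assms(2) \<open>open W\<close>] by simp
  then show ?thesis by (simp add: frechet_derivative_works)
qed

lemma local_defining_function_zero:
  assumes "local_defining_function UNIV \<Omega> p W \<rho>" "open \<Omega>" "p \<in> frontier \<Omega>"
  shows "\<rho> p = 0"
proof -
  have W: "open W" "p \<in> W" "\<Omega> \<inter> W = {z \<in> W. \<rho> z < 0}"
    using assms(1) by (auto simp: local_defining_function_def)
  have iff: "z \<in> \<Omega> \<longleftrightarrow> \<rho> z < 0" if "z \<in> W" for z
    using W(3) that by (auto simp: set_eq_iff)
  have "p \<notin> \<Omega>" "p \<in> closure \<Omega>"
    using assms(2,3) by (auto simp: frontier_def interior_open)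
  then have "\<not> \<rho> p < 0" using W by auto
  moreover have "\<not> \<rho> p > 0"
  proof
    assume "\<rho> p > 0"
    have "continuous_on W \<rho>"
      using assms(1) Ck_on.simps(1) by (metis local_defining_function_def smooth_on_def)
    then have "open {z \<in> W. \<rho> z > 0}"
      using continuous_open_preimage[OF _ W(1) open_greaterThan[of 0]]
      by (auto simp: vimage_def Int_def)
    then have "{z \<in> W. \<rho> z > 0} \<inter> \<Omega> \<noteq> {}"
      using \<open>\<rho> p > 0\<close> W(2) \<open>p \<in> closure \<Omega>\<close> by (subst open_Int_closure_eq_empty[symmetric]) auto
    then show False using iff by force
  qed
  ultimately show ?thesis by linarith
qed

lemma descending_direction:
  fixes \<rho> :: "'a::euclidean_space \<Rightarrow> real"
  assumes "(\<rho> has_derivative D) (at p)" "grad \<rho> p \<bullet> v < 0"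
  shows "\<forall>\<^sub>F t in at_right 0. \<rho> (p + t *\<^sub>R v) < \<rho> p"
proof -
  have "((\<lambda>t. p + t *\<^sub>R v) has_derivative (\<lambda>t. t *\<^sub>R v)) (at 0)"
    by (auto intro!: derivative_eq_intros)
  then have "((\<lambda>t. \<rho> (p + t *\<^sub>R v)) has_derivative (\<lambda>t. D (t *\<^sub>R v))) (at 0)"
    using has_derivative_compose[of "\<lambda>t. p + t *\<^sub>R v" "\<lambda>t. t *\<^sub>R v" 0 UNIV \<rho> D] assms(1) by simp
  then have "((\<lambda>t. \<rho> (p + t *\<^sub>R v)) has_real_derivative grad \<rho> p \<bullet> v) (at 0)"
    unfolding has_field_derivative_def
    by (rule has_derivative_eq_rhs)
       (simp add: has_derivative_grad[OF assms(1)] fun_eq_iff inner_commute mult.commute)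
  from has_real_derivative_neg_dec_right[OF this assms(2)]
  obtain d where "d > 0" "\<And>h. 0 < h \<Longrightarrow> h < d \<Longrightarrow> \<rho> (p + h *\<^sub>R v) < \<rho> p"
    by auto
  then show ?thesis unfolding eventually_at_right[OF zero_less_one] by auto
qed

text \<open>
  If the unit normals \<open>n\<close> and \<open>n'\<close> differ, then \<open>v = n' - n\<close> satisfies \<open>n \<cdot> v < 0 < n' \<cdot> v\<close>.
  Starting at \<open>p\<close> in the direction \<open>v\<close> one would thus enter \<open>\<Omega>\<close> according to the first
  defining function and stay outside according to the second.
\<close>

lemma unit_normal_unique:
  fixes \<Omega> :: "'a::euclidean_space set"
  assumes "open \<Omega>" "p \<in> frontier \<Omega>"
    and 1: "local_defining_function UNIV \<Omega> p W \<rho>"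
    and 2: "local_defining_function UNIV \<Omega> p W' \<rho>'"
  shows "grad \<rho> p /\<^sub>R norm (grad \<rho> p) = grad \<rho>' p /\<^sub>R norm (grad \<rho>' p)"
proof (rule ccontr)
  define n where "n = grad \<rho> p /\<^sub>R norm (grad \<rho> p)"
  define n' where "n' = grad \<rho>' p /\<^sub>R norm (grad \<rho>' p)"
  assume "\<not> ?thesis"
  then have neq: "n \<noteq> n'" by (simp add: n_def n'_def)
  have p: "p \<in> W" "p \<in> W'" "open W" "open W'" "grad \<rho> p \<noteq> 0" "grad \<rho>' p \<noteq> 0"
    and \<Omega>: "\<Omega> \<inter> W = {z \<in> W. \<rho> z < 0}" "\<Omega> \<inter> W' = {z \<in> W'. \<rho>' z < 0}"
    using 1 2 by (auto simp: local_defining_function_def)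
  have unit: "n \<bullet> n = 1" "n' \<bullet> n' = 1"
    using p by (simp_all add: n_def n'_def dot_square_norm power2_eq_square)
  \<comment> \<open>the direction that descends for \<open>\<rho>\<close> and ascends for \<open>\<rho>'\<close>\<close>
  define v where "v = n' - n"
  have "v \<bullet> v > 0" using neq by (simp add: v_def)
  then have lt: "n \<bullet> n' < 1"
    using unit by (simp add: v_def inner_diff_left inner_diff_right inner_commute)
  have "n \<bullet> v < 0" "n' \<bullet> (- v) < 0"
    using lt unit by (simp_all add: v_def inner_diff_right inner_commute)
  then have v: "grad \<rho> p \<bullet> v < 0" "grad \<rho>' p \<bullet> (- v) < 0"
    using p by (auto simp: n_def n'_def mult_less_0_iff zero_less_mult_iff)
  have z: "\<rho> p = 0" "\<rho>' p = 0"
    using local_defining_function_zero assms by blast+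
  have "((\<lambda>t. p + t *\<^sub>R v) \<longlongrightarrow> p + 0 *\<^sub>R v) (at_right 0)"
    by (intro tendsto_intros)
  then have ev1: "\<forall>\<^sub>F t in at_right 0. p + t *\<^sub>R v \<in> W \<inter> W'"
    using topological_tendstoD[of _ "p + 0 *\<^sub>R v" "at_right 0" "W \<inter> W'"] p by auto
  have ev2: "\<forall>\<^sub>F t in at_right 0. \<rho> (p + t *\<^sub>R v) < 0"
    using descending_direction[OF local_defining_function_has_derivative[OF 1 p(1)] v(1)] z by simp
  have ev3: "\<forall>\<^sub>F t in at_right 0. \<rho>' (p + t *\<^sub>R v) > 0"
  proof -
    have der: "((\<lambda>z. - \<rho>' z) has_derivative (\<lambda>h. - frechet_derivative \<rho>' (at p) h)) (at p)"
      by (intro has_derivative_minus local_defining_function_has_derivative[OF 2 p(2)])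
    have "v \<bullet> grad (\<lambda>z. - \<rho>' z) p = - (v \<bullet> grad \<rho>' p)"
      using has_derivative_grad[OF der, of v]
        has_derivative_grad[OF local_defining_function_has_derivative[OF 2 p(2)], of v] by simp
    then have "grad (\<lambda>z. - \<rho>' z) p \<bullet> v < 0" using v(2) by (simp add: inner_commute)
    from descending_direction[OF der this] show ?thesis using z by simp
  qed
  obtain t where t: "p + t *\<^sub>R v \<in> W \<inter> W'" "\<rho> (p + t *\<^sub>R v) < 0" "\<rho>' (p + t *\<^sub>R v) > 0"
    using eventually_happens'[OF trivial_limit_at_right_real eventually_conj[OF ev1 eventually_conj[OF ev2 ev3]]]
    by blast
  then have "p + t *\<^sub>R v \<in> \<Omega> \<inter> W" "p + t *\<^sub>R v \<notin> \<Omega> \<inter> W'" by (auto simp: \<Omega>)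
  then show False using t by auto
qed

lemma outer_normal_eq:
  fixes \<Omega> :: "'a::euclidean_space set"
  assumes "open \<Omega>" "p \<in> frontier \<Omega>" "local_defining_function UNIV \<Omega> p W \<rho>"
  shows "outer_normal \<Omega> p = grad \<rho> p /\<^sub>R norm (grad \<rho> p)"
  unfolding outer_normal_def
  using unit_normal_unique[OF assms(1,2)] assms(3) by (intro the_equality) blast+

section \<open>The domain\<close>

text \<open>
  Write \<open>Ln z\<^sub>1 = s + i \<phi>\<close> and \<open>z\<^sub>2 = a + i b\<close>.  The cylinder is \<open>s = b = 0\<close> with the coordinates
  \<open>(x, y) = (\<phi>, a)\<close>, and \<open>\<rho>\<^sub>0 = (\<phi> + a b)\<^sup>2 + (a (1 + s))\<^sup>2 + 16 s\<^sup>2 + 16 b\<^sup>2 - 1\<close> restricts to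
  \<open>x\<^sup>2 + y\<^sup>2 - 1\<close> on it.  The terms \<open>a b\<close> and \<open>a s\<close> tilt the gradient into
  \<open>2 (x \<partial>\<^sub>\<phi> + y \<partial>\<^sub>a + y (x \<partial>\<^sub>b + y \<partial>\<^sub>s)) = 2 (\<partial>\<^sub>\<nu> u + y I \<partial>\<^sub>\<tau> u)\<close>.  The terms \<open>16 s\<^sup>2 + 16 b\<^sup>2\<close>
  do not affect the first order along the cylinder; the factor \<open>16\<close> makes the sublevel set
  so thin that \<open>|\<phi>| < \<pi> / 2\<close> on it and the branch cut of \<open>Ln\<close> is not met.
\<close>

definition \<rho>\<^sub>0 :: "C2 \<Rightarrow> real" where
  "\<rho>\<^sub>0 z = (Im (Ln (fst z)) + Re (snd z) * Im (snd z))\<^sup>2 + (Re (snd z) * (1 + Re (Ln (fst z))))\<^sup>2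
     + 16 * (Re (Ln (fst z)))\<^sup>2 + 16 * (Im (snd z))\<^sup>2 - 1"

definition \<Omega>\<^sub>0 :: "C2 set" where
  "\<Omega>\<^sub>0 = {z. 0 < Re (fst z) \<and> \<rho>\<^sub>0 z < 0}"

definition D\<rho>\<^sub>0 :: "C2 \<Rightarrow> C2 \<Rightarrow> real" where
  "D\<rho>\<^sub>0 z h = 2 * (Im (Ln (fst z)) + Re (snd z) * Im (snd z))
       * (Im (inverse (fst z) * fst h) + Re (snd h) * Im (snd z) + Re (snd z) * Im (snd h))
     + 2 * (Re (snd z) * (1 + Re (Ln (fst z))))
       * (Re (snd h) * (1 + Re (Ln (fst z))) + Re (snd z) * Re (inverse (fst z) * fst h))
     + 32 * Re (Ln (fst z)) * Re (inverse (fst z) * fst h) + 32 * Im (snd z) * Im (snd h)"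

lemma right_half_not_nonpos: "0 < Re z \<Longrightarrow> z \<notin> \<real>\<^sub>\<le>\<^sub>0"
  by (auto simp: complex_nonpos_Reals_iff)

lemma \<rho>\<^sub>0_has_derivative:
  assumes "0 < Re (fst z)"
  shows "(\<rho>\<^sub>0 has_derivative D\<rho>\<^sub>0 z) (at z)"
proof -
  have "(fst has_derivative fst) (at z)" by (rule bounded_linear_imp_has_derivative[OF bounded_linear_fst])
  from has_derivative_compose[OF this
      has_field_derivative_Ln[OF right_half_not_nonpos[OF assms], unfolded has_field_derivative_def]]
  have Ln: "((\<lambda>z. Ln (fst z)) has_derivative (\<lambda>h. inverse (fst z) * fst h)) (at z)" .
  note l = bounded_linear.has_derivative[OF bounded_linear_Re Ln]
    bounded_linear.has_derivative[OF bounded_linear_Im Ln]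
    bounded_linear_imp_has_derivative[OF bounded_linear_compose[OF bounded_linear_Re bounded_linear_snd]]
    bounded_linear_imp_has_derivative[OF bounded_linear_compose[OF bounded_linear_Im bounded_linear_snd]]
  show ?thesis
    unfolding \<rho>\<^sub>0_def[abs_def] D\<rho>\<^sub>0_def[abs_def]
    by (rule derivative_eq_intros l refl)+ (simp add: algebra_simps)
qed

lemma smooth_on_\<rho>\<^sub>0:
  assumes "open W" "\<And>z. z \<in> W \<Longrightarrow> 0 < Re (fst z)"
  shows "smooth_on W \<rho>\<^sub>0"
  unfolding smooth_on_def
proof
  fix k
  note fat = locally_fat_open[OF assms(1)]
  have Ln: "Ck_on k W (\<lambda>z. Ln (fst z))"
    using assms(2) right_half_not_nonpos by (intro Ck_on_Ln[OF fat] Ck_on_linear[OF fat] bounded_linear_fst) blast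
  have sq: "Ck_on k W (\<lambda>z. (f z)\<^sup>2)" if "Ck_on k W f" for f :: "C2 \<Rightarrow> real"
    unfolding power2_eq_square by (rule Ck_on_mult[OF fat that that])
  note basic = Ck_on_linear_compose[OF fat bounded_linear_Re Ln] Ck_on_linear_compose[OF fat bounded_linear_Im Ln]
    Ck_on_linear_compose[OF fat bounded_linear_Re Ck_on_linear[OF fat bounded_linear_snd]]
    Ck_on_linear_compose[OF fat bounded_linear_Im Ck_on_linear[OF fat bounded_linear_snd]]
  show "Ck_on k W \<rho>\<^sub>0"
    unfolding \<rho>\<^sub>0_def[abs_def] diff_conv_add_uminus
    by (intro Ck_on_add[OF fat] sq Ck_on_mult[OF fat] Ck_on_const[OF fat] basic)
qed

text \<open>
  First \<open>|s|, |b| \<le> 1/4\<close>, then \<open>|a| \<le> 1 / (1 + s) \<le> 4/3\<close>, and finally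
  \<open>|\<phi>| \<le> 1 + |a| |b| \<le> 4/3 < \<pi> / 2\<close>.
\<close>

lemma \<rho>\<^sub>0_nonpos_bounds:
  assumes "\<rho>\<^sub>0 z \<le> 0"
  shows "\<bar>Re (Ln (fst z))\<bar> \<le> 1/4" "\<bar>Im (Ln (fst z))\<bar> \<le> 4/3"
proof -
  define s where "s = Re (Ln (fst z))"
  define f where "f = Im (Ln (fst z))"
  define a where "a = Re (snd z)"
  define b where "b = Im (snd z)"
  have r: "(f + a * b)\<^sup>2 + (a * (1 + s))\<^sup>2 + 16 * s\<^sup>2 + 16 * b\<^sup>2 \<le> 1"
    using assms by (simp add: \<rho>\<^sub>0_def s_def f_def a_def b_def)
  have nn: "0 \<le> (f + a * b)\<^sup>2" "0 \<le> (a * (1 + s))\<^sup>2" "0 \<le> s\<^sup>2" "0 \<le> b\<^sup>2" by simp_all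
  have "s\<^sup>2 \<le> 1/16" "b\<^sup>2 \<le> 1/16" "(f + a * b)\<^sup>2 \<le> 1" "(a * (1 + s))\<^sup>2 \<le> 1"
    using r nn by linarith+
  then have "s\<^sup>2 \<le> (1/4)\<^sup>2" "b\<^sup>2 \<le> (1/4)\<^sup>2" "(f + a * b)\<^sup>2 \<le> 1\<^sup>2" "(a * (1 + s))\<^sup>2 \<le> 1\<^sup>2"
    by (simp_all add: power_one_over)
  then have *: "\<bar>s\<bar> \<le> 1/4" "\<bar>b\<bar> \<le> 1/4" "\<bar>f + a * b\<bar> \<le> 1" "\<bar>a * (1 + s)\<bar> \<le> 1"
    by (simp_all only: abs_le_square_iff[symmetric] abs_divide abs_one abs_numeral)
  have "\<bar>a\<bar> * (3/4) \<le> \<bar>a\<bar> * \<bar>1 + s\<bar>" using *(1) by (intro mult_left_mono) auto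
  then have "\<bar>a\<bar> \<le> 4/3" using *(4) by (simp add: abs_mult)
  then have "\<bar>a\<bar> * \<bar>b\<bar> \<le> 4/3 * (1/4)" using *(2) by (intro mult_mono) auto
  then have "\<bar>a * b\<bar> \<le> 1/3" by (simp add: abs_mult)
  then show "\<bar>Re (Ln (fst z))\<bar> \<le> 1/4" "\<bar>Im (Ln (fst z))\<bar> \<le> 4/3"
    using *(1,3) by (auto simp: s_def[symmetric] f_def[symmetric])
qed

lemma cos_4_3_pos: "cos (4/3) > (0::real)"
  by (rule cos_gt_zero_pi) (use pi_gt3 in auto)

text \<open>
  The bounds on \<open>s\<close> and \<open>\<phi>\<close> keep \<open>Re z\<^sub>1 = exp s * cos \<phi>\<close> away from \<open>0\<close>.  So the frontier
  of \<open>\<Omega>\<^sub>0\<close> stays inside the half space where \<open>\<rho>\<^sub>0\<close> is smooth, and \<open>\<rho>\<^sub>0\<close> vanishes on it.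
\<close>

lemma closure_\<Omega>\<^sub>0: "z \<in> closure \<Omega>\<^sub>0 \<Longrightarrow> 0 < Re (fst z)"
proof -
  define d where "d = exp (-1/4) * cos (4/3 :: real)"
  have "d \<le> Re (fst z)" if "z \<in> \<Omega>\<^sub>0" for z
  proof -
    have nz: "fst z \<noteq> 0" using that by (auto simp: \<Omega>\<^sub>0_def)
    have b: "\<bar>Re (Ln (fst z))\<bar> \<le> 1/4" "\<bar>Im (Ln (fst z))\<bar> \<le> 4/3"
      using \<rho>\<^sub>0_nonpos_bounds that by (auto simp: \<Omega>\<^sub>0_def)
    have "cos (4/3) \<le> cos \<bar>Im (Ln (fst z))\<bar>"
      by (rule cos_monotone_0_pi_le) (use b pi_gt3 in auto)
    then have "d \<le> exp (Re (Ln (fst z))) * cos (Im (Ln (fst z)))"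
      unfolding d_def using b cos_4_3_pos by (intro mult_mono) auto
    also have "\<dots> = Re (exp (Ln (fst z)))" by (simp only: Re_exp)
    also have "\<dots> = Re (fst z)" using nz by simp
    finally show ?thesis .
  qed
  then have "\<Omega>\<^sub>0 \<subseteq> {z. d \<le> Re (fst z)}" by blast
  moreover have "closed {z :: C2. d \<le> Re (fst z)}" by (intro closed_Collect_le continuous_intros)
  ultimately have "closure \<Omega>\<^sub>0 \<subseteq> {z. d \<le> Re (fst z)}" by (rule closure_minimal)
  moreover have "d > 0" using cos_4_3_pos by (simp add: d_def)
  ultimately show "z \<in> closure \<Omega>\<^sub>0 \<Longrightarrow> 0 < Re (fst z)" by force
qed

text \<open>
  A neighbourhood of the whole frontier on which \<open>\<rho>\<^sub>0\<close> is smooth without critical points.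
\<close>

definition W\<^sub>0 :: "C2 set" where
  "W\<^sub>0 = {z. 0 < Re (fst z) \<and> - 1 < Re (Ln (fst z)) \<and> - 1 < \<rho>\<^sub>0 z}"

lemma open_right_half: "open {z :: C2. 0 < Re (fst z)}"
  by (intro open_Collect_less continuous_intros)

lemma continuous_on_\<rho>\<^sub>0: "continuous_on {z. 0 < Re (fst z)} \<rho>\<^sub>0"
  using has_derivative_continuous[OF \<rho>\<^sub>0_has_derivative] by (simp add: continuous_at_imp_continuous_on)

lemma open_\<Omega>\<^sub>0: "open \<Omega>\<^sub>0"
  using continuous_open_preimage[OF continuous_on_\<rho>\<^sub>0 open_right_half open_lessThan[of 0]]
  by (auto simp: \<Omega>\<^sub>0_def elim!: back_subst[of "open"])

lemma open_W\<^sub>0: "open W\<^sub>0"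
proof -
  have "continuous_on {z :: C2. 0 < Re (fst z)} (\<lambda>z. Re (Ln (fst z)))"
    by (auto intro!: continuous_intros right_half_not_nonpos)
  note this[THEN continuous_open_preimage, OF open_right_half open_greaterThan[of "-1"]]
    continuous_open_preimage[OF continuous_on_\<rho>\<^sub>0 open_right_half open_greaterThan[of "-1"]]
  note open_Int[OF this]
  then show ?thesis by (rule back_subst[of "open"]) (auto simp: W\<^sub>0_def)
qed

lemma grad_\<rho>\<^sub>0:
  assumes "0 < Re (fst z)"
  shows "h \<bullet> grad \<rho>\<^sub>0 z = D\<rho>\<^sub>0 z h"
  using has_derivative_grad[OF \<rho>\<^sub>0_has_derivative[OF assms]] by simp

text \<open>
  For \<open>s > -1\<close> the functions \<open>\<phi> + a b\<close>, \<open>a (1 + s)\<close>, \<open>s\<close>, \<open>b\<close> are local coordinates, so the only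
  critical point is their common zero, where \<open>\<rho>\<^sub>0 = -1\<close>.  The test vectors are multiples of
  \<open>z\<^sub>1\<close> in the first factor because \<open>d (Ln z\<^sub>1)\<close> takes \<open>z\<^sub>1 l\<close> to \<open>l\<close>.
\<close>

lemma grad_\<rho>\<^sub>0_nonzero:
  assumes "z \<in> W\<^sub>0"
  shows "grad \<rho>\<^sub>0 z \<noteq> 0"
proof
  assume 0: "grad \<rho>\<^sub>0 z = 0"
  have z: "0 < Re (fst z)" "- 1 < Re (Ln (fst z))" "- 1 < \<rho>\<^sub>0 z"
    using assms by (auto simp: W\<^sub>0_def)
  then have nz: "fst z \<noteq> 0" by auto
  have inv: "inverse (fst z) * (fst z * l) = l" for l using nz by simp
  have "D\<rho>\<^sub>0 z (fst z * l, c) = 0" for l c using grad_\<rho>\<^sub>0[OF z(1)] 0 by (metis inner_zero_right)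
  note D = this[unfolded D\<rho>\<^sub>0_def fst_conv snd_conv inv]
  have A: "Im (Ln (fst z)) + Re (snd z) * Im (snd z) = 0"
    using D[of \<i> 0] by (simp del: Re_Ln)
  have "Re (snd z) * (1 + Re (Ln (fst z))) * (1 + Re (Ln (fst z))) = 0"
    using D[of 0 1] A by (simp del: Re_Ln)
  then have a: "Re (snd z) = 0" using z(2) by (simp del: Re_Ln)
  have s: "Re (Ln (fst z)) = 0" using D[of 1 0] A a by (simp del: Re_Ln)
  have b: "Im (snd z) = 0" using D[of 0 \<i>] A a by (simp del: Re_Ln)
  have "\<rho>\<^sub>0 z = - 1" using A a s b by (simp add: \<rho>\<^sub>0_def del: Re_Ln)
  then show False using z(3) by simp
qed

lemma frontier_\<Omega>\<^sub>0:
  assumes "p \<in> frontier \<Omega>\<^sub>0"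
  shows "0 < Re (fst p)" "\<rho>\<^sub>0 p = 0"
proof -
  have cl: "p \<in> closure \<Omega>\<^sub>0" "p \<notin> \<Omega>\<^sub>0" using assms open_\<Omega>\<^sub>0 by (auto simp: frontier_def interior_open)
  then show Re: "0 < Re (fst p)" using closure_\<Omega>\<^sub>0 by blast
  have "\<not> \<rho>\<^sub>0 p > 0"
  proof
    assume "\<rho>\<^sub>0 p > 0"
    have "open {z. 0 < Re (fst z) \<and> 0 < \<rho>\<^sub>0 z}"
      using continuous_open_preimage[OF continuous_on_\<rho>\<^sub>0 open_right_half open_greaterThan[of 0]]
      by (rule back_subst[of "open"]) auto
    then have "{z. 0 < Re (fst z) \<and> 0 < \<rho>\<^sub>0 z} \<inter> \<Omega>\<^sub>0 \<noteq> {}"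
      using Re \<open>\<rho>\<^sub>0 p > 0\<close> cl(1) by (subst open_Int_closure_eq_empty[symmetric]) auto
    then show False by (auto simp: \<Omega>\<^sub>0_def)
  qed
  moreover have "\<not> \<rho>\<^sub>0 p < 0" using cl(2) Re by (simp add: \<Omega>\<^sub>0_def)
  ultimately show "\<rho>\<^sub>0 p = 0" by linarith
qed

lemma local_defining_function_\<rho>\<^sub>0:
  assumes "p \<in> frontier \<Omega>\<^sub>0"
  shows "local_defining_function UNIV \<Omega>\<^sub>0 p W\<^sub>0 \<rho>\<^sub>0"
proof -
  note p = frontier_\<Omega>\<^sub>0[OF assms]
  have "p \<in> W\<^sub>0" using p \<rho>\<^sub>0_nonpos_bounds(1)[of p] by (simp add: W\<^sub>0_def del: Re_Ln)
  moreover have "smooth_on W\<^sub>0 \<rho>\<^sub>0"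
    by (rule smooth_on_\<rho>\<^sub>0[OF open_W\<^sub>0]) (simp add: W\<^sub>0_def)
  moreover have "\<Omega>\<^sub>0 \<inter> W\<^sub>0 = {z \<in> UNIV \<inter> W\<^sub>0. \<rho>\<^sub>0 z < 0}" by (auto simp: \<Omega>\<^sub>0_def W\<^sub>0_def)
  ultimately show ?thesis
    using open_W\<^sub>0 grad_\<rho>\<^sub>0_nonzero by (simp add: local_defining_function_def)
qed

lemma smooth_boundary_\<Omega>\<^sub>0: "smooth_boundary \<Omega>\<^sub>0"
  unfolding smooth_boundary_def using local_defining_function_\<rho>\<^sub>0 by blast

lemma outer_normal_\<Omega>\<^sub>0_orthogonal:
  assumes "p \<in> frontier \<Omega>\<^sub>0" "v \<bullet> outer_normal \<Omega>\<^sub>0 p = 0"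
  shows "D\<rho>\<^sub>0 p v = 0"
proof -
  have "grad \<rho>\<^sub>0 p \<noteq> 0"
    using local_defining_function_\<rho>\<^sub>0[OF assms(1)] by (simp add: local_defining_function_def)
  then have "v \<bullet> grad \<rho>\<^sub>0 p = 0"
    using assms(2) outer_normal_eq[OF open_\<Omega>\<^sub>0 assms(1) local_defining_function_\<rho>\<^sub>0[OF assms(1)]] by simp
  then show ?thesis using grad_\<rho>\<^sub>0 frontier_\<Omega>\<^sub>0(1)[OF assms(1)] by simp
qed

text \<open>
  The map \<open>G\<close> inverts the coordinates \<open>(\<phi> + a b, a (1 + s), 4 s, 4 b)\<close>, in which \<open>\<rho>\<^sub>0 + 1\<close> is the
  squared norm, and \<open>\<Omega>\<^sub>0\<close> is the image of the unit ball.
\<close>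

lemma connected_\<Omega>\<^sub>0: "connected \<Omega>\<^sub>0"
proof -
  define s where "s w = Re (snd w) / 4" for w :: C2
  define b where "b w = Im (snd w) / 4" for w :: C2
  define a where "a w = Im (fst w) / (1 + s w)" for w :: C2
  define f where "f w = Re (fst w) - a w * b w" for w :: C2
  define G where "G w = (exp (Complex (s w) (f w)), Complex (a w) (b w))" for w
  have s: "\<bar>s w\<bar> < 1/4" if "w \<in> ball 0 1" for w
    using that norm_snd_le[of "snd w" "fst w"] abs_Re_le_cmod[of "snd w"] by (simp add: s_def)
  have s1: "1 + s w > 0" if "w \<in> ball 0 1" for w using s[OF that] by linarith
  have \<rho>: "(f w + a w * b w)\<^sup>2 + (a w * (1 + s w))\<^sup>2 + 16 * (s w)\<^sup>2 + 16 * (b w)\<^sup>2 = (norm w)\<^sup>2"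
    if "1 + s w > 0" for w
    using that by (simp add: f_def a_def b_def s_def norm_prod_def cmod_power2 power_divide)
  have "\<Omega>\<^sub>0 = G ` ball 0 1"
  proof (intro equalityI subsetI)
    fix z assume z: "z \<in> \<Omega>\<^sub>0"
    then have nz: "fst z \<noteq> 0" by (auto simp: \<Omega>\<^sub>0_def)
    have b4: "\<bar>Re (Ln (fst z))\<bar> \<le> 1/4" using \<rho>\<^sub>0_nonpos_bounds(1)[of z] z by (simp add: \<Omega>\<^sub>0_def del: Re_Ln)
    define w where "w = (Complex (Im (Ln (fst z)) + Re (snd z) * Im (snd z)) (Re (snd z) * (1 + Re (Ln (fst z)))),
       Complex (4 * Re (Ln (fst z))) (4 * Im (snd z)))"
    have w: "s w = Re (Ln (fst z))" "b w = Im (snd z)" "a w = Re (snd z)" "f w = Im (Ln (fst z))"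
      using b4 by (simp_all add: s_def b_def a_def f_def w_def del: Re_Ln)
    have "(norm w)\<^sup>2 = \<rho>\<^sub>0 z + 1"
      using \<rho>[of w] b4 by (simp add: w \<rho>\<^sub>0_def del: Re_Ln)
    then have "(norm w)\<^sup>2 < 1" using z by (simp add: \<Omega>\<^sub>0_def)
    then have "w \<in> ball 0 1" by (simp add: abs_square_less_1)
    moreover have "G w = z"
      using nz by (simp add: G_def w complex_surj prod_eq_iff del: Re_Ln)
    ultimately show "z \<in> G ` ball 0 1" by blast
  next
    fix z assume "z \<in> G ` ball 0 1"
    then obtain w where w: "w \<in> ball 0 1" "z = G w" by blast
    have "(norm w)\<^sup>2 < 1" using w(1) by (simp add: abs_square_less_1)
    have b: "\<bar>b w\<bar> < 1/4" "\<bar>Re (fst w)\<bar> < 1" "\<bar>Im (fst w)\<bar> < 1"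
      using w(1) norm_snd_le[of "snd w" "fst w"] abs_Im_le_cmod[of "snd w"] norm_fst_le[of "fst w" "snd w"]
        abs_Im_le_cmod[of "fst w"] abs_Re_le_cmod[of "fst w"] by (simp_all add: b_def)
    have "\<bar>a w\<bar> \<le> 4/3"
    proof -
      have "\<bar>Im (fst w)\<bar> \<le> 4/3 * (1 + s w)" using b(3) s[OF w(1)] by (auto simp: abs_if split: if_splits)
      then show ?thesis using s1[OF w(1)] by (simp add: a_def abs_div field_simps)
    qed
    then have "\<bar>a w\<bar> * \<bar>b w\<bar> \<le> 4/3 * (1/4)" using b by (intro mult_mono) auto
    then have "\<bar>a w * b w\<bar> \<le> 1/3" by (simp add: abs_mult)
    then have f: "\<bar>f w\<bar> < 4/3" using b(2) unfolding f_def by linarith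
    have Ln: "Ln (exp (Complex (s w) (f w))) = Complex (s w) (f w)"
      using f pi_gt3 by (intro Ln_exp) auto
    have "cos (f w) > 0" using f pi_gt3 by (intro cos_gt_zero_pi) auto
    then have "Re (fst z) > 0" using w by (simp add: G_def Re_exp)
    moreover have "\<rho>\<^sub>0 z = (norm w)\<^sup>2 - 1"
      using \<rho>[OF s1[OF w(1)]] by (simp add: w G_def \<rho>\<^sub>0_def Ln del: Re_Ln)
    ultimately show "z \<in> \<Omega>\<^sub>0" using \<open>(norm w)\<^sup>2 < 1\<close> by (simp add: \<Omega>\<^sub>0_def)
  qed
  moreover have "continuous_on (ball 0 1) G"
  proof -
    have c: "continuous_on (ball 0 1) s" "continuous_on (ball 0 1) b"
      unfolding s_def[abs_def] b_def[abs_def] by (intro continuous_intros; simp)+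
    have "continuous_on (ball 0 1) a"
      unfolding a_def[abs_def] using s1 by (intro continuous_intros c) force
    then show ?thesis
      unfolding G_def[abs_def] f_def Complex_eq by (intro continuous_intros c)
  qed
  ultimately show ?thesis
    using connected_continuous_image[OF _ convex_connected[OF convex_ball]] by metis
qed

section \<open>The cylinder\<close>

definition u\<^sub>0 :: "R2 \<Rightarrow> C2" where
  "u\<^sub>0 p = (cis (fst p), complex_of_real (snd p))"

lemma frechet_derivative_within_cdisc:
  assumes "p \<in> cdisc" "(f has_derivative D) (at p within cdisc)"
  shows "frechet_derivative f (at p within cdisc) = D"
  using frechet_derivative_within_fat[OF locally_fat_cball assms] by simp

lemma d_x_d_y_eq:
  assumes "p \<in> cdisc" "(f has_derivative D) (at p)"
  shows "d_x f p = D (1, 0)" "d_y f p = D (0, 1)"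
  using frechet_derivative_within_cdisc[OF assms(1) has_derivative_at_withinI[OF assms(2)]]
  by (simp_all add: d_x_def d_y_def)

lemma d_x_d_y_cong:
  assumes "p \<in> cdisc" "\<And>q. q \<in> cdisc \<Longrightarrow> f q = g q" "(g has_derivative D) (at p)"
  shows "d_x f p = D (1, 0)" "d_y f p = D (0, 1)"
proof -
  have "(f has_derivative D) (at p within cdisc)"
    by (rule has_derivative_transform[OF assms(1) _ has_derivative_at_withinI[OF assms(3)]])
       (simp add: assms(2))
  from frechet_derivative_within_cdisc[OF assms(1) this]
  show "d_x f p = D (1, 0)" "d_y f p = D (0, 1)" by (simp_all add: d_x_def d_y_def)
qed

lemma cis_fst_has_derivative:
  "((\<lambda>p. cis (fst p)) has_derivative (\<lambda>h. complex_of_real (fst h) * (\<i> * cis (fst p)))) (at p)"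
proof -
  have "((\<lambda>p. exp (\<i> * complex_of_real (fst p))) has_derivative
      (\<lambda>h. exp (\<i> * complex_of_real (fst p)) * (\<i> * complex_of_real (fst h)))) (at p)"
    by (rule has_derivative_compose[OF _ DERIV_exp[unfolded has_field_derivative_def]])
       (auto intro!: derivative_eq_intros)
  then show ?thesis by (simp add: cis_conv_exp mult_ac)
qed

lemma u\<^sub>0_has_derivative:
  "(u\<^sub>0 has_derivative (\<lambda>h. (complex_of_real (fst h) * (\<i> * cis (fst p)), complex_of_real (snd h)))) (at p)"
  unfolding u\<^sub>0_def[abs_def]
  by (intro has_derivative_Pair cis_fst_has_derivative) (auto intro!: derivative_eq_intros)

lemma smooth_u\<^sub>0: "smooth_on cdisc u\<^sub>0"
  unfolding smooth_on_def
proof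
  fix k
  have fat: "locally_fat cdisc" by (rule locally_fat_cball) simp
  have bl: "bounded_linear (\<lambda>p::R2. complex_of_real (fst p))" "bounded_linear (\<lambda>p::R2. complex_of_real (snd p))"
    by (intro bounded_linear_compose[OF bounded_linear_of_real] bounded_linear_fst bounded_linear_snd)+
  show "Ck_on k cdisc u\<^sub>0"
    unfolding u\<^sub>0_def[abs_def] cis_conv_exp
    by (intro Ck_on_Pair[OF fat] Ck_on_exp[OF fat] Ck_on_mult[OF fat] Ck_on_const[OF fat]
        Ck_on_linear[OF fat] bl)
qed

lemma d_u\<^sub>0:
  assumes "p \<in> cdisc"
  shows "d_x u\<^sub>0 p = (\<i> * cis (fst p), 0)" "d_y u\<^sub>0 p = (0, 1)"
  using d_x_d_y_eq[OF assms u\<^sub>0_has_derivative] by simp_all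

lemma conformal_u\<^sub>0: "conformal u\<^sub>0"
proof -
  have "inj (frechet_derivative u\<^sub>0 (at p within cdisc))" if "p \<in> cdisc" for p
    unfolding frechet_derivative_within_cdisc[OF that has_derivative_at_withinI[OF u\<^sub>0_has_derivative]]
    by (auto simp: inj_def prod_eq_iff)
  moreover have "weakly_conformal u\<^sub>0"
    unfolding weakly_conformal_def by (intro always_eventually allI impI) (simp add: d_u\<^sub>0 norm_prod_def norm_mult)
  ultimately show ?thesis by (simp add: conformal_def immersion_def)
qed

lemma lagrangian_u\<^sub>0: "lagrangian u\<^sub>0"
  unfolding lagrangian_def by (intro always_eventually allI impI) (simp add: d_u\<^sub>0 omega_def)

lemma lagrangian_angle_u\<^sub>0: "lagrangian_angle u\<^sub>0 (\<lambda>p. \<i> * cis (fst p))"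
proof -
  have c: "continuous_on UNIV (\<lambda>p::R2. \<i> * cis (fst p))" by (intro continuous_intros)
  have "(\<lambda>p::R2. \<i> * cis (fst p)) \<in> borel_measurable (lebesgue_on disc)"
    by (intro continuous_imp_measurable_on_sets_lebesgue continuous_on_subset[OF c]) auto
  then show ?thesis
    unfolding lagrangian_angle_def
    by (auto simp: d_u\<^sub>0 dz1_wedge_dz2_def norm_prod_def norm_mult intro!: always_eventually)
qed

text \<open>
  The Laplacian of \<open>u\<^sub>0\<close> is \<open>(- e\<^sup>i\<^sup>x, 0)\<close>.
\<close>

lemma not_minimal_u\<^sub>0: "\<not> minimal u\<^sub>0"
proof
  assume "minimal u\<^sub>0"
  then have "d_x (d_x u\<^sub>0) 0 + d_y (d_y u\<^sub>0) 0 = 0" by (simp add: minimal_def harmonic_def)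
  moreover have "d_x (d_x u\<^sub>0) 0 = (-1, 0)"
  proof -
    have "((\<lambda>p. (\<i> * cis (fst p), 0)) has_derivative
        (\<lambda>h. (\<i> * (complex_of_real (fst h) * (\<i> * cis (fst p))), 0))) (at p)" for p
      by (intro has_derivative_Pair has_derivative_mult_right cis_fst_has_derivative has_derivative_const)
    from d_x_d_y_cong(1)[OF _ d_u\<^sub>0(1) this, of 0] show ?thesis by simp
  qed
  moreover have "d_y (d_y u\<^sub>0) 0 = 0"
    using d_x_d_y_cong(2)[OF _ d_u\<^sub>0(2) has_derivative_const, of 0] by simp
  ultimately show False by (simp add: zero_prod_def)
qed

lemma \<rho>\<^sub>0_u\<^sub>0:
  assumes "p \<in> cdisc"
  shows "0 < Re (fst (u\<^sub>0 p))" "Ln (fst (u\<^sub>0 p)) = \<i> * fst p" "\<rho>\<^sub>0 (u\<^sub>0 p) = (norm p)\<^sup>2 - 1"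
proof -
  have x: "\<bar>fst p\<bar> \<le> 1" using assms norm_fst_le[of "fst p" "snd p"] by simp
  have "0 < cos (fst p)" using x pi_gt3 by (intro cos_gt_zero_pi) auto
  then show "0 < Re (fst (u\<^sub>0 p))" by (simp add: u\<^sub>0_def)
  show L: "Ln (fst (u\<^sub>0 p)) = \<i> * fst p"
    unfolding u\<^sub>0_def fst_conv cis_conv_exp using x pi_gt3 by (intro Ln_exp) auto
  show "\<rho>\<^sub>0 (u\<^sub>0 p) = (norm p)\<^sup>2 - 1"
    unfolding \<rho>\<^sub>0_def L by (simp add: u\<^sub>0_def norm_R2)
qed

text \<open>
  On the cylinder \<open>\<rho>\<^sub>0\<close> is \<open>|p|\<^sup>2 - 1\<close>, so the open disc is mapped into \<open>\<Omega>\<^sub>0\<close> and the unit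
  circle to the zero set of \<open>\<rho>\<^sub>0\<close>.
\<close>

lemma u\<^sub>0_boundary: "u\<^sub>0 ` sphere 0 1 \<subseteq> frontier \<Omega>\<^sub>0"
proof
  fix z assume "z \<in> u\<^sub>0 ` sphere 0 1"
  then obtain p where p: "norm p = 1" "z = u\<^sub>0 p" by auto
  have "u\<^sub>0 ` disc \<subseteq> \<Omega>\<^sub>0"
    using \<rho>\<^sub>0_u\<^sub>0 by (auto simp: \<Omega>\<^sub>0_def abs_square_less_1)
  then have mono: "closure (u\<^sub>0 ` disc) \<subseteq> closure \<Omega>\<^sub>0" by (rule closure_mono)
  have "u\<^sub>0 ` closure disc \<subseteq> closure (u\<^sub>0 ` disc)"
    by (intro continuous_image_closure_subset[of UNIV])
       (auto simp: continuous_at_imp_continuous_on has_derivative_continuous[OF u\<^sub>0_has_derivative])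
  moreover have "p \<in> closure disc" using p by simp
  ultimately have "z \<in> closure \<Omega>\<^sub>0" unfolding p(2) using mono by blast
  moreover have "z \<notin> \<Omega>\<^sub>0" using \<rho>\<^sub>0_u\<^sub>0(3)[of p] p by (simp add: \<Omega>\<^sub>0_def)
  ultimately show "z \<in> frontier \<Omega>\<^sub>0" using open_\<Omega>\<^sub>0 by (simp add: frontier_def interior_open)
qed

section \<open>The first variation along Hamiltonian fields\<close>

text \<open>
  The partial derivatives of \<open>g \<circ> u\<^sub>0\<close>.  The moving vector \<open>\<partial>\<^sub>x u\<close> is split into the fixed directions
  \<open>(1, 0)\<close> and \<open>(i, 0)\<close>, because regularity of \<open>g\<close> is expressed by derivatives in fixed directions.
\<close>

definition along_x :: "(C2 \<Rightarrow> real) \<Rightarrow> R2 \<Rightarrow> real" where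
  "along_x g p = cos (fst p) * frechet_derivative g (at (u\<^sub>0 p)) (\<i>, 0)
     - sin (fst p) * frechet_derivative g (at (u\<^sub>0 p)) (1, 0)"

definition along_y :: "(C2 \<Rightarrow> real) \<Rightarrow> R2 \<Rightarrow> real" where
  "along_y g p = frechet_derivative g (at (u\<^sub>0 p)) (0, 1)"

lemma smooth_compose_u\<^sub>0:
  assumes "smooth_on UNIV g"
  shows "((\<lambda>q. g (u\<^sub>0 q)) has_derivative (\<lambda>h. fst h * along_x g p + snd h * along_y g p)) (at p)"
    and "continuous_on UNIV (along_x g)" "continuous_on UNIV (along_y g)"
    and "continuous_on UNIV (\<lambda>q. g (u\<^sub>0 q))"
proof -
  have lin: "linear (frechet_derivative g (at z))" for z
    using smooth_on_SucD(1)[OF assms] has_derivative_linear by blast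
  have dec: "(complex_of_real s * (\<i> * cis x), complex_of_real t)
      = (s * - sin x) *\<^sub>R (1, 0) + (s * cos x) *\<^sub>R (\<i>, 0) + t *\<^sub>R (0, 1)" for s t x
    by (simp add: complex_eq_iff)
  have eq: "frechet_derivative g (at (u\<^sub>0 p)) (complex_of_real s * (\<i> * cis (fst p)), complex_of_real t)
      = s * along_x g p + t * along_y g p" for s t
    unfolding dec linear_add[OF lin] linear_scale[OF lin]
    by (simp add: along_x_def along_y_def algebra_simps)
  show "((\<lambda>q. g (u\<^sub>0 q)) has_derivative (\<lambda>h. fst h * along_x g p + snd h * along_y g p)) (at p)"
    using has_derivative_compose[OF u\<^sub>0_has_derivative[of p] smooth_on_SucD(1)[OF assms]]
    by (simp only: eq)
  have cu: "continuous_on UNIV u\<^sub>0"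
    by (simp add: continuous_at_imp_continuous_on has_derivative_continuous[OF u\<^sub>0_has_derivative])
  have sm: "continuous_on UNIV g'" if "smooth_on UNIV g'" for g' :: "C2 \<Rightarrow> real"
    using that Ck_on_continuous unfolding smooth_on_def by blast
  have "continuous_on UNIV (\<lambda>q. frechet_derivative g (at (u\<^sub>0 q)) v)" for v
    using continuous_on_compose2[OF sm[OF smooth_on_SucD(2)[OF assms]] cu subset_UNIV] .
  then show "continuous_on UNIV (along_x g)" "continuous_on UNIV (along_y g)"
    unfolding along_x_def[abs_def] along_y_def[abs_def] by (auto intro!: continuous_intros)
  show "continuous_on UNIV (\<lambda>q. g (u\<^sub>0 q))"
    using continuous_on_compose2[OF sm[OF assms] cu subset_UNIV] .
qed

lemma hessian_symmetric:
  fixes f :: "C2 \<Rightarrow> real"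
  assumes "smooth_on UNIV f"
  shows "frechet_derivative (\<lambda>z. frechet_derivative f (at z) v) (at z) w
       = frechet_derivative (\<lambda>z. frechet_derivative f (at z) w) (at z) v"
proof -
  note s = smooth_on_SucD(2)[OF assms]
  have "continuous_on UNIV (\<lambda>z. frechet_derivative (\<lambda>z. frechet_derivative f (at z) v) (at z) w)" for v w
    using smooth_on_SucD(2)[OF s] Ck_on_continuous unfolding smooth_on_def by blast
  then show ?thesis
    by (intro second_derivative_symmetric[OF smooth_on_SucD(1)[OF assms]
          smooth_on_SucD(1)[OF s] smooth_on_SucD(1)[OF s]])
qed

lemma hamiltonian_field_components:
  assumes "smooth_on UNIV f"
  shows "I_mult (grad f z) =
    (Complex (- frechet_derivative f (at z) (\<i>, 0)) (frechet_derivative f (at z) (1, 0)),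
     Complex (- frechet_derivative f (at z) (0, \<i>)) (frechet_derivative f (at z) (0, 1)))"
  using has_derivative_grad[OF smooth_on_SucD(1)[OF assms, of z]]
  by (simp add: I_mult_def inner_prod_def complex_eq_iff inner_complex_def)

text \<open>
  With \<open>F = f \<circ> u\<^sub>0\<close> and \<open>X = I \<nabla>f\<close>, the field is
  \<open>W = (X \<cdot> \<partial>\<^sub>x u + y \<partial>\<^sub>y F, X \<cdot> \<partial>\<^sub>y u - y \<partial>\<^sub>x F)\<close>.  It arises from
  \<open>(X \<cdot> \<partial>\<^sub>x u - F, X \<cdot> \<partial>\<^sub>y u)\<close> by adding the divergence free field \<open>(\<partial>\<^sub>y (y F), - \<partial>\<^sub>x (y F))\<close>; the
  terms with \<open>F\<close> itself cancel, so that \<open>W\<close> contains first derivatives of \<open>f\<close> only.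
\<close>

context
  fixes f :: "C2 \<Rightarrow> real" and f1 f2 f3 f4 :: "C2 \<Rightarrow> real" and W1 W2 :: "R2 \<Rightarrow> real"
  assumes f: "smooth_on UNIV f"
  defines "f1 \<equiv> \<lambda>z. frechet_derivative f (at z) (1, 0)"
    and "f2 \<equiv> \<lambda>z. frechet_derivative f (at z) (\<i>, 0)"
    and "f3 \<equiv> \<lambda>z. frechet_derivative f (at z) (0, 1)"
    and "f4 \<equiv> \<lambda>z. frechet_derivative f (at z) (0, \<i>)"
  defines "W1 \<equiv> \<lambda>p. cos (fst p) * f1 (u\<^sub>0 p) + sin (fst p) * f2 (u\<^sub>0 p) + snd p * f3 (u\<^sub>0 p)"
    and "W2 \<equiv> \<lambda>p. - f4 (u\<^sub>0 p) - snd p * (cos (fst p) * f2 (u\<^sub>0 p) - sin (fst p) * f1 (u\<^sub>0 p))"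
begin

lemma smooth_partials: "smooth_on UNIV f1" "smooth_on UNIV f2" "smooth_on UNIV f3" "smooth_on UNIV f4"
  unfolding f1_def f2_def f3_def f4_def by (rule smooth_on_SucD(2)[OF f])+

lemma energy_density:
  assumes "p \<in> cdisc"
  shows "d_x (\<lambda>q. I_mult (grad f (u\<^sub>0 q))) p \<bullet> d_x u\<^sub>0 p + d_y (\<lambda>q. I_mult (grad f (u\<^sub>0 q))) p \<bullet> d_y u\<^sub>0 p
    = sin (fst p) * along_x f2 p + cos (fst p) * along_x f1 p - along_y f4 p"
proof -
  note s = smooth_compose_u\<^sub>0(1)[OF smooth_partials(1), of p] smooth_compose_u\<^sub>0(1)[OF smooth_partials(2), of p]
    smooth_compose_u\<^sub>0(1)[OF smooth_partials(3), of p] smooth_compose_u\<^sub>0(1)[OF smooth_partials(4), of p]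
  have "((\<lambda>q. (complex_of_real (- f2 (u\<^sub>0 q)) + \<i> * complex_of_real (f1 (u\<^sub>0 q)),
        complex_of_real (- f4 (u\<^sub>0 q)) + \<i> * complex_of_real (f3 (u\<^sub>0 q)))) has_derivative
    (\<lambda>h. (complex_of_real (- (fst h * along_x f2 p + snd h * along_y f2 p))
           + \<i> * complex_of_real (fst h * along_x f1 p + snd h * along_y f1 p),
          complex_of_real (- (fst h * along_x f4 p + snd h * along_y f4 p))
           + \<i> * complex_of_real (fst h * along_x f3 p + snd h * along_y f3 p)))) (at p)"
    by (intro has_derivative_Pair has_derivative_add has_derivative_mult_right has_derivative_of_real
        has_derivative_minus s)
  moreover have "(\<lambda>q. I_mult (grad f (u\<^sub>0 q))) = (\<lambda>q. (complex_of_real (- f2 (u\<^sub>0 q)) + \<i> * complex_of_real (f1 (u\<^sub>0 q)),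
        complex_of_real (- f4 (u\<^sub>0 q)) + \<i> * complex_of_real (f3 (u\<^sub>0 q))))"
    by (simp add: hamiltonian_field_components[OF f] Complex_eq f1_def f2_def f3_def f4_def)
  ultimately show ?thesis
    using d_x_d_y_eq[OF assms, of "\<lambda>q. I_mult (grad f (u\<^sub>0 q))"] d_u\<^sub>0[OF assms]
    by (simp add: inner_prod_def inner_complex_def)
qed

text \<open>
  This is \<open>\<partial>\<^sub>x (\<partial>\<^sub>y F) = \<partial>\<^sub>y (\<partial>\<^sub>x F)\<close> for \<open>F = f \<circ> u\<^sub>0\<close>, with \<open>\<partial>\<^sub>x F = cos x f2 - sin x f1\<close> and
  \<open>\<partial>\<^sub>y F = f3\<close>.  It makes the correction \<open>(\<partial>\<^sub>y (y F), - \<partial>\<^sub>x (y F))\<close> divergence free.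
\<close>

lemma mixed_partials_cancel:
  "along_x f3 p + sin (fst p) * along_y f1 p - cos (fst p) * along_y f2 p = 0"
  unfolding along_x_def along_y_def f1_def f2_def f3_def
  using hessian_symmetric[OF f, of "(0, 1)" "u\<^sub>0 p" "(1, 0)"] hessian_symmetric[OF f, of "(0, 1)" "u\<^sub>0 p" "(\<i>, 0)"]
  by simp

lemma W_derivatives:
  "(W1 has_derivative (\<lambda>h. fst h * (cos (fst p) * along_x f1 p - sin (fst p) * f1 (u\<^sub>0 p)
        + sin (fst p) * along_x f2 p + cos (fst p) * f2 (u\<^sub>0 p) + snd p * along_x f3 p)
     + snd h * (cos (fst p) * along_y f1 p + sin (fst p) * along_y f2 p + f3 (u\<^sub>0 p) + snd p * along_y f3 p))) (at p)"
  "(W2 has_derivative (\<lambda>h. fst h * (- along_x f4 p - snd p * (cos (fst p) * along_x f2 p - sin (fst p) * f2 (u\<^sub>0 p)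
        - sin (fst p) * along_x f1 p - cos (fst p) * f1 (u\<^sub>0 p)))
     + snd h * (- along_y f4 p - (cos (fst p) * f2 (u\<^sub>0 p) - sin (fst p) * f1 (u\<^sub>0 p))
        - snd p * (cos (fst p) * along_y f2 p - sin (fst p) * along_y f1 p)))) (at p)"
proof -
  note s = smooth_compose_u\<^sub>0(1)[OF smooth_partials(1), of p] smooth_compose_u\<^sub>0(1)[OF smooth_partials(2), of p]
    smooth_compose_u\<^sub>0(1)[OF smooth_partials(3), of p] smooth_compose_u\<^sub>0(1)[OF smooth_partials(4), of p]
  have t: "((\<lambda>p::R2. cos (fst p)) has_derivative (\<lambda>h. - (fst h * sin (fst p)))) (at p)"
    "((\<lambda>p::R2. sin (fst p)) has_derivative (\<lambda>h. fst h * cos (fst p))) (at p)"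
    "((\<lambda>p::R2. snd p) has_derivative snd) (at p)"
    by (auto intro!: derivative_eq_intros simp: fun_eq_iff)
  have 1: "((\<lambda>p. cos (fst p) * f1 (u\<^sub>0 p)) has_derivative
     (\<lambda>h. fst h * (cos (fst p) * along_x f1 p - sin (fst p) * f1 (u\<^sub>0 p)) + snd h * (cos (fst p) * along_y f1 p))) (at p)"
    by (rule has_derivative_eq_rhs[OF has_derivative_mult[OF t(1) s(1)]]) (simp add: algebra_simps)
  have 2: "((\<lambda>p. sin (fst p) * f2 (u\<^sub>0 p)) has_derivative
     (\<lambda>h. fst h * (sin (fst p) * along_x f2 p + cos (fst p) * f2 (u\<^sub>0 p)) + snd h * (sin (fst p) * along_y f2 p))) (at p)"
    by (rule has_derivative_eq_rhs[OF has_derivative_mult[OF t(2) s(2)]]) (simp add: algebra_simps)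
  have 3: "((\<lambda>p. snd p * f3 (u\<^sub>0 p)) has_derivative
     (\<lambda>h. fst h * (snd p * along_x f3 p) + snd h * (f3 (u\<^sub>0 p) + snd p * along_y f3 p))) (at p)"
    by (rule has_derivative_eq_rhs[OF has_derivative_mult[OF t(3) s(3)]]) (simp add: algebra_simps)
  show "(W1 has_derivative (\<lambda>h. fst h * (cos (fst p) * along_x f1 p - sin (fst p) * f1 (u\<^sub>0 p)
        + sin (fst p) * along_x f2 p + cos (fst p) * f2 (u\<^sub>0 p) + snd p * along_x f3 p)
     + snd h * (cos (fst p) * along_y f1 p + sin (fst p) * along_y f2 p + f3 (u\<^sub>0 p) + snd p * along_y f3 p))) (at p)"
    unfolding W1_def
    by (rule has_derivative_eq_rhs[OF has_derivative_add[OF has_derivative_add[OF 1 2] 3]]) (simp add: algebra_simps)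
  have 4: "((\<lambda>p. cos (fst p) * f2 (u\<^sub>0 p)) has_derivative
     (\<lambda>h. fst h * (cos (fst p) * along_x f2 p - sin (fst p) * f2 (u\<^sub>0 p)) + snd h * (cos (fst p) * along_y f2 p))) (at p)"
    by (rule has_derivative_eq_rhs[OF has_derivative_mult[OF t(1) s(2)]]) (simp add: algebra_simps)
  have 5: "((\<lambda>p. sin (fst p) * f1 (u\<^sub>0 p)) has_derivative
     (\<lambda>h. fst h * (sin (fst p) * along_x f1 p + cos (fst p) * f1 (u\<^sub>0 p)) + snd h * (sin (fst p) * along_y f1 p))) (at p)"
    by (rule has_derivative_eq_rhs[OF has_derivative_mult[OF t(2) s(1)]]) (simp add: algebra_simps)
  show "(W2 has_derivative (\<lambda>h. fst h * (- along_x f4 p - snd p * (cos (fst p) * along_x f2 p - sin (fst p) * f2 (u\<^sub>0 p)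
        - sin (fst p) * along_x f1 p - cos (fst p) * f1 (u\<^sub>0 p)))
     + snd h * (- along_y f4 p - (cos (fst p) * f2 (u\<^sub>0 p) - sin (fst p) * f1 (u\<^sub>0 p))
        - snd p * (cos (fst p) * along_y f2 p - sin (fst p) * along_y f1 p)))) (at p)"
    unfolding W2_def
    by (rule has_derivative_eq_rhs[OF has_derivative_diff[OF has_derivative_minus[OF s(4)]
          has_derivative_mult[OF t(3) has_derivative_diff[OF 4 5]]]]) (simp add: algebra_simps)
qed

lemma W_vanishes_outside_support:
  assumes "u\<^sub>0 p \<notin> closure {z. f z \<noteq> 0}"
  shows "\<forall>\<^sub>F q in nhds p. W1 q = 0 \<and> W2 q = 0"
proof -
  define N where "N = - closure {z. f z \<noteq> 0}"
  have N: "open N" "u\<^sub>0 p \<in> N" using assms by (auto simp: N_def)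
  have "frechet_derivative f (at z) v = 0" if "z \<in> N" for z v
  proof -
    have "(f has_derivative (\<lambda>h. 0)) (at z)"
      by (rule has_derivative_transform_within_open[OF has_derivative_const[of 0] N(1) that])
         (use closure_subset[of "{z. f z \<noteq> 0}"] in \<open>auto simp: N_def\<close>)
    then show ?thesis using has_derivative_unique[OF smooth_on_SucD(1)[OF f]] by metis
  qed
  moreover have "\<forall>\<^sub>F q in nhds p. u\<^sub>0 q \<in> N"
    using has_derivative_continuous[OF u\<^sub>0_has_derivative[of p]] N
    by (intro topological_tendstoD) (simp_all add: isCont_def tendsto_at_iff_tendsto_nhds)
  ultimately show ?thesis
    by (elim eventually_mono) (simp add: W1_def W2_def f1_def f2_def f3_def f4_def)
qed

text \<open>
  The radial component of \<open>W\<close> is \<open>X \<cdot> (\<partial>\<^sub>\<nu> u + y I \<partial>\<^sub>\<tau> u)\<close>, which is half the derivative of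
  \<open>\<rho>\<^sub>0\<close> along \<open>X\<close>.
\<close>

lemma W_tangential:
  assumes "p \<in> cdisc" "D\<rho>\<^sub>0 (u\<^sub>0 p) (I_mult (grad f (u\<^sub>0 p))) = 0"
  shows "fst p * W1 p + snd p * W2 p = 0"
proof -
  have "D\<rho>\<^sub>0 (u\<^sub>0 p) (I_mult (grad f (u\<^sub>0 p))) = 2 * (fst p * W1 p + snd p * W2 p)"
    unfolding D\<rho>\<^sub>0_def \<rho>\<^sub>0_u\<^sub>0(2)[OF assms(1)] hamiltonian_field_components[OF f]
    by (simp add: u\<^sub>0_def W1_def W2_def f1_def f2_def f3_def f4_def algebra_simps)
  then show ?thesis using assms(2) by simp
qed

text \<open>
  The energy density is the divergence of \<open>W\<close>.
\<close>

lemma first_variation_zero: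
  assumes U: "openin (top_of_set cdisc) U"
    and supp: "closure {z. f z \<noteq> 0} \<inter> u\<^sub>0 ` (frontier U \<inter> disc) = {}"
    and tang: "\<And>p. p \<in> closure U \<inter> sphere 0 1 \<Longrightarrow> D\<rho>\<^sub>0 (u\<^sub>0 p) (I_mult (grad f (u\<^sub>0 p))) = 0"
  shows "(LINT p:U|lborel. d_x (\<lambda>q. I_mult (grad f (u\<^sub>0 q))) p \<bullet> d_x u\<^sub>0 p
       + d_y (\<lambda>q. I_mult (grad f (u\<^sub>0 q))) p \<bullet> d_y u\<^sub>0 p) = 0"
    (is "(LINT p:U|lborel. ?J p) = 0")
proof -
  define a1 where "a1 p = cos (fst p) * along_x f1 p - sin (fst p) * f1 (u\<^sub>0 p)
        + sin (fst p) * along_x f2 p + cos (fst p) * f2 (u\<^sub>0 p) + snd p * along_x f3 p" for p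
  define b1 where "b1 p = cos (fst p) * along_y f1 p + sin (fst p) * along_y f2 p + f3 (u\<^sub>0 p) + snd p * along_y f3 p" for p
  define a2 where "a2 p = - along_x f4 p - snd p * (cos (fst p) * along_x f2 p - sin (fst p) * f2 (u\<^sub>0 p)
        - sin (fst p) * along_x f1 p - cos (fst p) * f1 (u\<^sub>0 p))" for p
  define b2 where "b2 p = - along_y f4 p - (cos (fst p) * f2 (u\<^sub>0 p) - sin (fst p) * f1 (u\<^sub>0 p))
        - snd p * (cos (fst p) * along_y f2 p - sin (fst p) * along_y f1 p)" for p
  have "(LINT p:U|lborel. a1 p + b2 p) = 0"
  proof (rule divergence_theorem_tangential[OF U, of W1 a1 b1 W2 a2 b2])
    show "(W1 has_derivative (\<lambda>h. fst h * a1 p + snd h * b1 p)) (at p)"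
      "(W2 has_derivative (\<lambda>h. fst h * a2 p + snd h * b2 p)) (at p)" for p
      unfolding a1_def b1_def a2_def b2_def by (rule W_derivatives)+
    note c = smooth_partials[THEN smooth_compose_u\<^sub>0(2)] smooth_partials[THEN smooth_compose_u\<^sub>0(3)]
      smooth_partials[THEN smooth_compose_u\<^sub>0(4)]
    show "continuous_on UNIV a1" "continuous_on UNIV b1" "continuous_on UNIV a2" "continuous_on UNIV b2"
      unfolding a1_def[abs_def] b1_def[abs_def] a2_def[abs_def] b2_def[abs_def]
      by (intro continuous_intros c)+
    show "\<forall>\<^sub>F q in nhds p. W1 q = 0 \<and> W2 q = 0" if "p \<in> frontier U \<inter> disc" for p
      using that supp by (intro W_vanishes_outside_support) blast
    show "fst p * W1 p + snd p * W2 p = 0" if "p \<in> closure U \<inter> sphere 0 1" for p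
      using that tang[OF that] by (intro W_tangential) auto
  qed
  moreover have "(LINT p:U|lborel. ?J p) = (LINT p:U|lborel. a1 p + b2 p)"
  proof (rule set_lebesgue_integral_cong)
    show "U \<in> sets lborel" using U by (auto simp: openin_open)
    show "\<forall>p. p \<in> U \<longrightarrow> ?J p = a1 p + b2 p"
    proof (intro allI impI)
      fix p assume "p \<in> U"
      then have p: "p \<in> cdisc" using openin_imp_subset[OF U] by blast
      have "a1 p + b2 p = sin (fst p) * along_x f2 p + cos (fst p) * along_x f1 p - along_y f4 p
          + snd p * (along_x f3 p + sin (fst p) * along_y f1 p - cos (fst p) * along_y f2 p)"
        by (simp add: a1_def b2_def algebra_simps)
      then show "?J p = a1 p + b2 p"
        using energy_density[OF p] mixed_partials_cancel[of p] by simp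
    qed
  qed
  ultimately show ?thesis by simp
qed

end

lemma free_boundary_u\<^sub>0: "free_boundary_ham_stationary_loc \<Omega>\<^sub>0 u\<^sub>0"
  unfolding free_boundary_ham_stationary_loc_def
proof (intro conjI allI impI)
  show "Ck_on 1 cdisc u\<^sub>0" using smooth_u\<^sub>0 by (simp only: smooth_on_def)
  fix U f
  assume U: "smooth_relative_domain cdisc U" and f: "admissible_hamiltonian \<Omega>\<^sub>0 u\<^sub>0 U f"
  obtain W where W: "u\<^sub>0 ` (closure U \<inter> sphere 0 1) \<subseteq> W"
    "\<And>z. z \<in> W \<inter> frontier \<Omega>\<^sub>0 \<Longrightarrow> I_mult (grad f z) \<bullet> outer_normal \<Omega>\<^sub>0 z = 0"
    using f unfolding admissible_hamiltonian_def by blast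
  show "(LINT p:U|lborel. d_x (\<lambda>q. I_mult (grad f (u\<^sub>0 q))) p \<bullet> d_x u\<^sub>0 p
       + d_y (\<lambda>q. I_mult (grad f (u\<^sub>0 q))) p \<bullet> d_y u\<^sub>0 p) = 0"
  proof (rule first_variation_zero)
    show "D\<rho>\<^sub>0 (u\<^sub>0 p) (I_mult (grad f (u\<^sub>0 p))) = 0" if "p \<in> closure U \<inter> sphere 0 1" for p
    proof (rule outer_normal_\<Omega>\<^sub>0_orthogonal)
      show "u\<^sub>0 p \<in> frontier \<Omega>\<^sub>0" using that u\<^sub>0_boundary by blast
      then show "I_mult (grad f (u\<^sub>0 p)) \<bullet> outer_normal \<Omega>\<^sub>0 (u\<^sub>0 p) = 0"
        using that W by blast
    qed
  qed (use U f in \<open>simp_all add: smooth_relative_domain_def admissible_hamiltonian_def\<close>)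
qed (rule lagrangian_u\<^sub>0 u\<^sub>0_boundary)+

theorem lemma4p2:
  shows "\<exists>(u :: real \<times> real \<Rightarrow> complex \<times> complex) (\<Omega> :: (complex \<times> complex) set).
           smooth_on cdisc u \<and> conformal u \<and> lagrangian u \<and>
           (\<exists>\<beta>. lagrangian_angle u \<beta> \<and> continuous_on cdisc \<beta>) \<and>
           open \<Omega> \<and> connected \<Omega> \<and> \<Omega> \<noteq> {} \<and> smooth_boundary \<Omega> \<and>
           free_boundary_ham_stationary_loc \<Omega> u \<and>
           \<not> minimal u"
proof (intro exI conjI)
  show "continuous_on cdisc (\<lambda>p::R2. \<i> * cis (fst p))" by (intro continuous_intros)
  have "u\<^sub>0 0 \<in> \<Omega>\<^sub>0" using \<rho>\<^sub>0_u\<^sub>0[of 0] by (simp add: \<Omega>\<^sub>0_def)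
  then show "\<Omega>\<^sub>0 \<noteq> {}" by blast
qed (rule smooth_u\<^sub>0 conformal_u\<^sub>0 lagrangian_u\<^sub>0 lagrangian_angle_u\<^sub>0 open_\<Omega>\<^sub>0 connected_\<Omega>\<^sub>0
      smooth_boundary_\<Omega>\<^sub>0 free_boundary_u\<^sub>0 not_minimal_u\<^sub>0)+

end
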